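(* Decision trees of size $s$ over $n$ variables can be properly learned under the uniform distribution on $\{0,1\}^n$ to error $\varepsilon$ in time $\mathrm{poly}(n, s^{\log(s/\varepsilon)\log(1/\varepsilon)})$ using membership queries.
   Context: Size of a decision tree = number of leaves; logarithms base 2. Proper learning under the uniform distribution: given access to an unknown target $f:\{0,1\}^n\to\{\pm1\}$ computable by a size-$s$ decision tree, and a parameter $\varepsilon$, the algorithm outputs (with high probability) a decision tree $h$ with $\Pr_{\mathbf{x}}[h(\mathbf{x})\ne f(\mathbf{x})]\le\varepsilon$, $\mathbf{x}$ uniform on $\{0,1\}^n$. A membership query returns $f(x)$ for any chosen $x$. *)

theory Defs
  imports "HOL-Probability.Probability"
begin

section \<open>Boolean functions and decision trees\<close>

text \<open>Points of the cube are bit lists; the two values of a function are the integers 1 and -1.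
  A function on \<open>n\<close> variables is a function on all lists of which only the values on \<open>cube n\<close> matter.\<close>

definition cube :: "nat \<Rightarrow> bool list set" where
  "cube n = {x. length x = n}"

datatype dtree = Leaf int | Node nat dtree dtree

primrec dt_wf :: "nat \<Rightarrow> dtree \<Rightarrow> bool" where
  "dt_wf n (Leaf y) \<longleftrightarrow> y \<in> {-1, 1}"
| "dt_wf n (Node i l r) \<longleftrightarrow> i < n \<and> dt_wf n l \<and> dt_wf n r"

primrec dt_eval :: "dtree \<Rightarrow> bool list \<Rightarrow> int" where
  "dt_eval (Leaf y) x = y"
| "dt_eval (Node i l r) x = (if x ! i then dt_eval r x else dt_eval l x)"

primrec leaves :: "dtree \<Rightarrow> nat" where
  "leaves (Leaf y) = 1"
| "leaves (Node i l r) = leaves l + leaves r"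

text \<open>As usual, ``size \<open>s\<close>'' means size at most \<open>s\<close>.\<close>

definition dt_computable :: "nat \<Rightarrow> nat \<Rightarrow> (bool list \<Rightarrow> int) \<Rightarrow> bool" where
  "dt_computable n s f \<longleftrightarrow>
     (\<exists>t. dt_wf n t \<and> leaves t \<le> s \<and> (\<forall>x\<in>cube n. dt_eval t x = f x))"

definition dt_error :: "nat \<Rightarrow> dtree \<Rightarrow> (bool list \<Rightarrow> int) \<Rightarrow> real" where
  "dt_error n h f = measure_pmf.prob (pmf_of_set (cube n)) {x. dt_eval h x \<noteq> f x}"


section \<open>The machine model\<close>

text \<open>Algorithms are programs of a first-order, call-by-value functional language whose data are
  binary trees (the language F of N. D. Jones, ``Computability and Complexity'', whose running times
  are polynomially related to those of Turing machines), extended by fair coin flips, membership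
  queries, and access to the binary digits of the real accuracy parameter.

  A program is a list of function bodies. Every function has one argument; variables are
  de Bruijn indices into the environment. \<open>Atom\<close> is false, and every pair counts as true.\<close>

datatype val = Atom | Pair val val

datatype expr =
    Var nat
  | Const_Atom
  | Mk_Pair expr expr
  | Fst expr
  | Snd expr
  | If expr expr expr
  | Let expr expr
  | Call nat expr
  | Flip
  | Query expr
  | Digit expr

type_synonym program = "expr list"

primrec val_fst :: "val \<Rightarrow> val" where
  "val_fst Atom = Atom"
| "val_fst (Pair u v) = u"

primrec val_snd :: "val \<Rightarrow> val" where
  "val_snd Atom = Atom"
| "val_snd (Pair u v) = v"

definition enc_bool :: "bool \<Rightarrow> val" where
  "enc_bool b = (if b then Pair Atom Atom else Atom)"

definition enc_sign :: "int \<Rightarrow> val" where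
  "enc_sign y = enc_bool (y = 1)"

primrec enc_bits :: "bool list \<Rightarrow> val" where
  "enc_bits [] = Atom"
| "enc_bits (b # bs) = Pair (enc_bool b) (enc_bits bs)"

primrec enc_nat :: "nat \<Rightarrow> val" where
  "enc_nat 0 = Atom"
| "enc_nat (Suc k) = Pair Atom (enc_nat k)"

primrec enc_dtree :: "dtree \<Rightarrow> val" where
  "enc_dtree (Leaf y) = Pair Atom (enc_sign y)"
| "enc_dtree (Node i l r) =
     Pair (Pair Atom Atom) (Pair (enc_nat i) (Pair (enc_dtree l) (enc_dtree r)))"

text \<open>For \<open>0 < \<epsilon> < 1\<close> these are the digits of \<open>\<epsilon> = 0.d\<^sub>1d\<^sub>2\<dots>\<close> in base 2.\<close>

definition digit :: "real \<Rightarrow> nat \<Rightarrow> bool" where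
  "digit \<epsilon> k \<longleftrightarrow> odd \<lfloor>\<epsilon> * 2 ^ k\<rfloor>"

text \<open>\<open>eval p n f \<epsilon> env r e v r' t\<close>: with coin tape \<open>r\<close>, the expression \<open>e\<close> evaluates to \<open>v\<close> in
  \<open>t\<close> steps and leaves the tape \<open>r'\<close>. Each construct costs one step; in addition, a query costs
  the \<open>n\<close> steps for reading the query point, and access to the \<open>k\<close>-th digit of \<open>\<epsilon>\<close> costs \<open>k\<close>
  steps. Ill-formed queries and flips on an exhausted tape have no result.\<close>

inductive eval ::
  "program \<Rightarrow> nat \<Rightarrow> (bool list \<Rightarrow> int) \<Rightarrow> real \<Rightarrow>
   val list \<Rightarrow> bool list \<Rightarrow> expr \<Rightarrow> val \<Rightarrow> bool list \<Rightarrow> nat \<Rightarrow> bool"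
  for p :: program and n :: nat and f :: "bool list \<Rightarrow> int" and \<epsilon> :: real
where
  Var: "i < length env \<Longrightarrow> eval p n f \<epsilon> env r (Var i) (env ! i) r 1"
| Const_Atom: "eval p n f \<epsilon> env r Const_Atom Atom r 1"
| Mk_Pair: "eval p n f \<epsilon> env r a u r1 t1 \<Longrightarrow> eval p n f \<epsilon> env r1 b v r2 t2 \<Longrightarrow>
    eval p n f \<epsilon> env r (Mk_Pair a b) (Pair u v) r2 (t1 + t2 + 1)"
| Fst: "eval p n f \<epsilon> env r a v r1 t \<Longrightarrow> eval p n f \<epsilon> env r (Fst a) (val_fst v) r1 (t + 1)"
| Snd: "eval p n f \<epsilon> env r a v r1 t \<Longrightarrow> eval p n f \<epsilon> env r (Snd a) (val_snd v) r1 (t + 1)"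
| If_true: "eval p n f \<epsilon> env r c u r1 t1 \<Longrightarrow> u \<noteq> Atom \<Longrightarrow> eval p n f \<epsilon> env r1 a v r2 t2 \<Longrightarrow>
    eval p n f \<epsilon> env r (If c a b) v r2 (t1 + t2 + 1)"
| If_false: "eval p n f \<epsilon> env r c Atom r1 t1 \<Longrightarrow> eval p n f \<epsilon> env r1 b v r2 t2 \<Longrightarrow>
    eval p n f \<epsilon> env r (If c a b) v r2 (t1 + t2 + 1)"
| Let: "eval p n f \<epsilon> env r a u r1 t1 \<Longrightarrow> eval p n f \<epsilon> (u # env) r1 b v r2 t2 \<Longrightarrow>
    eval p n f \<epsilon> env r (Let a b) v r2 (t1 + t2 + 1)"
| Call: "j < length p \<Longrightarrow> eval p n f \<epsilon> env r a u r1 t1 \<Longrightarrow> eval p n f \<epsilon> [u] r1 (p ! j) v r2 t2 \<Longrightarrow>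
    eval p n f \<epsilon> env r (Call j a) v r2 (t1 + t2 + 1)"
| Flip: "eval p n f \<epsilon> env (b # r) Flip (enc_bool b) r 1"
| Query: "eval p n f \<epsilon> env r a (enc_bits x) r1 t \<Longrightarrow> x \<in> cube n \<Longrightarrow>
    eval p n f \<epsilon> env r (Query a) (enc_sign (f x)) r1 (t + n + 1)"
| Digit: "eval p n f \<epsilon> env r a (enc_nat k) r1 t \<Longrightarrow>
    eval p n f \<epsilon> env r (Digit a) (enc_bool (digit \<epsilon> k)) r1 (t + k + 1)"

text \<open>A run calls function 0 on the pair of \<open>n\<close> and \<open>s\<close>. Since evaluation may share
  subtrees, the size of the output tree can exceed the number of steps; the running time therefore
  includes the time for writing out the output (\<open>size\<close> counts the pairs of a value).\<close>

definition runs ::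
  "program \<Rightarrow> nat \<Rightarrow> nat \<Rightarrow> real \<Rightarrow> (bool list \<Rightarrow> int) \<Rightarrow> bool list \<Rightarrow> val \<Rightarrow> nat \<Rightarrow> bool" where
  "runs p n s \<epsilon> f r v T \<longleftrightarrow>
     (\<exists>r' t. eval p n f \<epsilon> [Pair (enc_nat n) (enc_nat s)] r (Call 0 (Var 0)) v r' t
           \<and> T = t + size v)"


section \<open>Proper learning under the uniform distribution\<close>

text \<open>The program \<open>p\<close> properly learns size-\<open>s\<close> decision trees over \<open>n\<close> variables to error \<open>\<epsilon>\<close>
  with failure probability at most \<open>\<delta>\<close> in worst-case time \<open>T\<close>: whatever the coins, it stops within
  time \<open>T\<close>. As every flip costs a step, a tape of \<open>T\<close> coins is all that a run can use.\<close>

definition properly_learns :: "program \<Rightarrow> nat \<Rightarrow> nat \<Rightarrow> real \<Rightarrow> real \<Rightarrow> nat \<Rightarrow> bool" where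
  "properly_learns p n s \<epsilon> \<delta> T \<longleftrightarrow>
     (\<forall>f. dt_computable n s f \<longrightarrow>
        (\<forall>r. length r = T \<longrightarrow> (\<exists>v t. runs p n s \<epsilon> f r v t \<and> t \<le> T)) \<and>
        measure_pmf.prob (pmf_of_set {r. length r = T})
          {r. \<exists>h t. runs p n s \<epsilon> f r (enc_dtree h) t \<and> dt_wf n h \<and> dt_error n h f \<le> \<epsilon>}
        \<ge> 1 - \<delta>)"


section \<open>Results of runs are unique\<close>

lemma enc_bool_inject: "enc_bool a = enc_bool b \<longleftrightarrow> a = b"
  by (simp add: enc_bool_def)

lemma enc_bits_inject: "enc_bits x = enc_bits y \<longleftrightarrow> x = y"
proof (induction x arbitrary: y)
  case Nil then show ?case by (cases y) auto
next
  case (Cons a x) then show ?case by (cases y) (auto simp: enc_bool_inject)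
qed

lemma enc_nat_inject: "enc_nat i = enc_nat j \<longleftrightarrow> i = j"
proof (induction i arbitrary: j)
  case 0 then show ?case by (cases j) auto
next
  case (Suc i) then show ?case by (cases j) auto
qed

lemma enc_dtree_inject:
  "dt_wf n g \<Longrightarrow> dt_wf n h \<Longrightarrow> enc_dtree g = enc_dtree h \<longleftrightarrow> g = h"
proof (induction g arbitrary: h)
  case (Leaf y) then show ?case by (cases h) (auto simp: enc_sign_def enc_bool_def)
next
  case (Node i l r) then show ?case by (cases h) (auto simp: enc_nat_inject)
qed

lemma eval_deterministic:
  "eval p n f \<epsilon> env r e v r1 t \<Longrightarrow> eval p n f \<epsilon> env r e v' r1' t' \<Longrightarrow>
   v' = v \<and> r1' = r1 \<and> t' = t"
proof (induction arbitrary: v' r1' t' rule: eval.induct)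
  case Var from Var.prems show ?case by cases auto
next
  case Const_Atom from Const_Atom.prems show ?case by cases auto
next
  case Mk_Pair from Mk_Pair.prems show ?case by cases (use Mk_Pair.IH in blast)
next
  case Fst from Fst.prems show ?case by cases (use Fst.IH in blast)
next
  case Snd from Snd.prems show ?case by cases (use Snd.IH in blast)
next
  case If_true from If_true.prems show ?case by cases (use If_true.IH If_true.hyps in blast)+
next
  case If_false from If_false.prems show ?case by cases (use If_false.IH in blast)+
next
  case Let from Let.prems show ?case by cases (use Let.IH in blast)
next
  case Call from Call.prems show ?case by cases (use Call.IH in blast)
next
  case Flip from Flip.prems show ?case by cases auto
next
  case Query from Query.prems show ?case
    by cases (use Query.IH in \<open>metis enc_bits_inject\<close>)
next
  case Digit from Digit.prems show ?case
    by cases (use Digit.IH in \<open>metis enc_nat_inject\<close>)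
qed

end

theory Submission
  imports Defs
begin

text \<open>
  Fix a sample \<open>S\<close> of random points. Starting from the all-ones mask, switch off one coordinate after
  the other as long as \<open>f (x AND mask) = f x\<close> for all \<open>x\<close> in \<open>S\<close>. A coordinate that has to be
  kept is relevant for \<open>f\<close>, so fewer than \<open>s\<close> coordinates survive, and on \<open>S\<close> the target agrees
  with a tree of size \<open>s\<close> over these coordinates: fix the others to 0.

  A tree consistent with \<open>S\<close> is then found by the search of Ehrenfeucht and Haussler: if a tree has at
  most \<open>2 ^ r\<close> leaves, then one of the subtrees of its root has at most \<open>2 ^ (r - 1)\<close>. Hence try
  all root variables with budget \<open>r - 1\<close> for both subtrees; as soon as one side succeeds, that
  variable can be kept and only the other side needs the full budget \<open>r\<close>. With
  \<open>r = \<lfloor>log s\<rfloor> + 1\<close> this takes \<open>s ^ O(log s)\<close> steps and yields at most \<open>2 ^ (r * r)\<close> leaves. There are so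
  few trees of that size that, by Occam's razor, every one that is consistent with a sample of about
  \<open>n * 2 ^ (r * r) / \<epsilon>\<close> points has error at most \<open>\<epsilon>\<close>.

  For \<open>s \<ge> 2\<close> and \<open>\<epsilon> < 7/8\<close> all of this is polynomial in \<open>n\<close> and
  \<open>s ^ (log (s / \<epsilon>) * log (1 / \<epsilon>))\<close>. That power tends to 1 as \<open>\<epsilon>\<close> does, and it
  is 1 for \<open>s = 1\<close>; then even reading \<open>s\<close> or \<open>\<epsilon>\<close> would take too long, but a constant, chosen
  by majority vote over polynomially many samples, is good enough.
\<close>

section \<open>The program\<close>

abbreviation (input) "e_true \<equiv> Mk_Pair Const_Atom Const_Atom"
abbreviation (input) "e_iff a b \<equiv> If a b (If b Const_Atom e_true)"

section \<open>Unary arithmetic and the leading digit of \<epsilon>\<close>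

definition "f_append = If (Fst (Var 0))
  (Mk_Pair (Fst (Fst (Var 0))) (Call 1 (Mk_Pair (Snd (Fst (Var 0))) (Snd (Var 0))))) (Snd (Var 0))"
definition "f_mul = If (Fst (Var 0))
  (Call 1 (Mk_Pair (Snd (Var 0)) (Call 2 (Mk_Pair (Snd (Fst (Var 0))) (Snd (Var 0)))))) Const_Atom"
definition "f_pow2 = If (Var 0) (Let (Call 3 (Snd (Var 0))) (Call 1 (Mk_Pair (Var 0) (Var 0)))) e_true"
definition "f_half = If (Var 0)
  (If (Snd (Var 0)) (Mk_Pair Const_Atom (Call 4 (Snd (Snd (Var 0))))) Const_Atom) Const_Atom"
definition "f_bit_length = If (Var 0) (Mk_Pair Const_Atom (Call 5 (Call 4 (Var 0)))) Const_Atom"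
definition "f_first_digit = If (Digit (Var 0)) (Var 0) (Call 6 (Mk_Pair Const_Atom (Var 0)))"

section \<open>Drawing a labelled sample from the coins\<close>

definition "f_point = If (Var 0) (Mk_Pair Flip (Call 7 (Snd (Var 0)))) Const_Atom"
definition "f_sample = If (Snd (Var 0))
  (Let (Call 7 (Fst (Var 0)))
    (Mk_Pair (Mk_Pair (Var 0) (Query (Var 0)))
      (Call 8 (Mk_Pair (Fst (Var 1)) (Snd (Snd (Var 1)))))))
  Const_Atom"

section \<open>Masks and the elimination of variables\<close>

definition "f_band = If (Fst (Var 0))
  (Mk_Pair (If (Fst (Fst (Var 0))) (Fst (Snd (Var 0))) Const_Atom)
    (Call 9 (Mk_Pair (Snd (Fst (Var 0))) (Snd (Snd (Var 0)))))) Const_Atom"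
definition "f_pad = If (Fst (Var 0))
  (Call 10 (Mk_Pair (Snd (Fst (Var 0))) (Mk_Pair e_true (Snd (Var 0))))) (Snd (Var 0))"
definition "f_agrees = If (Fst (Var 0))
  (If (e_iff (Query (Call 9 (Mk_Pair (Fst (Fst (Fst (Var 0)))) (Snd (Var 0))))) (Snd (Fst (Fst (Var 0)))))
    (Call 11 (Mk_Pair (Snd (Fst (Var 0))) (Snd (Var 0)))) Const_Atom) e_true"
text \<open>The argument consists of the sample, the number of undecided coordinates, the mask for
  the decided ones and the kept variables. Going downwards lets the decremented counter serve as the
  index of the coordinate, while the mask grows at its front.\<close>

definition "f_elim = If (Fst (Snd (Var 0)))
  (If (Call 11 (Mk_Pair (Fst (Var 0))
        (Call 10 (Mk_Pair (Snd (Fst (Snd (Var 0)))) (Mk_Pair Const_Atom (Fst (Snd (Snd (Var 0)))))))))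
    (Call 12 (Mk_Pair (Fst (Var 0)) (Mk_Pair (Snd (Fst (Snd (Var 0))))
      (Mk_Pair (Mk_Pair Const_Atom (Fst (Snd (Snd (Var 0))))) (Snd (Snd (Snd (Var 0))))))))
    (Call 12 (Mk_Pair (Fst (Var 0)) (Mk_Pair (Snd (Fst (Snd (Var 0))))
      (Mk_Pair (Mk_Pair e_true (Fst (Snd (Snd (Var 0)))))
        (Mk_Pair (Snd (Fst (Snd (Var 0)))) (Snd (Snd (Snd (Var 0))))))))))
  (Snd (Snd (Snd (Var 0))))"

section \<open>Search for a consistent tree\<close>

definition "f_all = If (Fst (Var 0))
  (If (e_iff (Snd (Fst (Fst (Var 0)))) (Snd (Var 0)))
    (Call 13 (Mk_Pair (Snd (Fst (Var 0))) (Snd (Var 0)))) Const_Atom) e_true"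
definition "f_nth = If (Snd (Var 0))
  (Call 14 (Mk_Pair (Snd (Fst (Var 0))) (Snd (Snd (Var 0))))) (Fst (Fst (Var 0)))"
definition "f_split = If (Fst (Var 0))
  (Let (Call 15 (Mk_Pair (Snd (Fst (Var 0))) (Snd (Var 0))))
    (If (e_iff (Call 14 (Mk_Pair (Fst (Fst (Fst (Var 1)))) (Fst (Snd (Var 1))))) (Snd (Snd (Var 1))))
      (Mk_Pair (Fst (Fst (Var 1))) (Var 0)) (Var 0)))
  Const_Atom"
text \<open>The first two results are the encodings of \<open>Leaf 1\<close> and
  \<open>Leaf (-1)\<close>; a bare \<open>Const_Atom\<close> reports failure.\<close>

definition "f_search = If (Call 13 (Mk_Pair (Snd (Snd (Var 0))) e_true)) (Mk_Pair Const_Atom e_true)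
  (If (Call 13 (Mk_Pair (Snd (Snd (Var 0))) Const_Atom)) (Mk_Pair Const_Atom Const_Atom)
    (If (Fst (Var 0))
      (Call 17 (Mk_Pair (Fst (Var 0)) (Mk_Pair (Snd (Snd (Var 0)))
        (Mk_Pair Const_Atom (Fst (Snd (Var 0)))))))
      Const_Atom))"
text \<open>The nested binders hold, from the outside in: the remaining variables, the two halves of
  the sample, and the trees found for these.\<close>
definition "f_search_split = If (Snd (Snd (Snd (Var 0))))
  (Let (Call 1 (Mk_Pair (Fst (Snd (Snd (Var 0)))) (Snd (Snd (Snd (Snd (Var 0)))))))
  (Let (Call 15 (Mk_Pair (Fst (Snd (Var 1))) (Mk_Pair (Fst (Snd (Snd (Snd (Var 1))))) Const_Atom)))
  (Let (Call 15 (Mk_Pair (Fst (Snd (Var 2))) (Mk_Pair (Fst (Snd (Snd (Snd (Var 2))))) e_true)))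
  (Let (Call 16 (Mk_Pair (Snd (Fst (Var 3))) (Mk_Pair (Var 2) (Var 1))))
  (Let (Call 16 (Mk_Pair (Snd (Fst (Var 4))) (Mk_Pair (Var 3) (Var 1))))
    (If (If (Var 1) e_true (Var 0))
      (Let (If (Var 1) (Var 1) (Call 16 (Mk_Pair (Fst (Var 5)) (Mk_Pair (Var 4) (Var 3)))))
      (Let (If (Var 1) (Var 1) (Call 16 (Mk_Pair (Fst (Var 6)) (Mk_Pair (Var 5) (Var 3)))))
        (If (Var 1) (If (Var 0)
            (Mk_Pair e_true (Mk_Pair (Fst (Snd (Snd (Snd (Var 7))))) (Mk_Pair (Var 1) (Var 0))))
            Const_Atom) Const_Atom)))
      (Call 17 (Mk_Pair (Fst (Var 5)) (Mk_Pair (Fst (Snd (Var 5)))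
        (Mk_Pair (Mk_Pair (Fst (Snd (Snd (Snd (Var 5))))) (Fst (Snd (Snd (Var 5)))))
          (Snd (Snd (Snd (Snd (Var 5)))))))))))))))
  Const_Atom"

section \<open>Majority vote and the main function\<close>

definition "f_majority = If (Fst (Var 0))
  (If (Snd (Fst (Fst (Var 0))))
    (Call 18 (Mk_Pair (Snd (Fst (Var 0)))
      (Mk_Pair (Mk_Pair Const_Atom (Fst (Snd (Var 0)))) (Snd (Snd (Var 0))))))
    (Call 18 (Mk_Pair (Snd (Fst (Var 0)))
      (Mk_Pair (Fst (Snd (Var 0))) (Mk_Pair Const_Atom (Snd (Snd (Var 0))))))))
  (Call 19 (Snd (Var 0)))"
definition "f_greater = If (Fst (Var 0))
  (If (Snd (Var 0)) (Call 19 (Mk_Pair (Snd (Fst (Var 0))) (Snd (Snd (Var 0))))) e_true) Const_Atom"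

primrec add_const :: "nat \<Rightarrow> expr \<Rightarrow> expr" where
  "add_const 0 e = e"
| "add_const (Suc c) e = Mk_Pair Const_Atom (add_const c e)"

declare add_const.simps [simp del]

text \<open>\<open>Snd (Snd (Var 0))\<close> is \<open>s - 1\<close> in unary, so
  \<open>s = 1\<close> is recognised without reading all of \<open>s\<close>. Three leading digits 1
  mean \<epsilon> \<ge> 7/8.\<close>

definition "f_easy = If (Snd (Snd (Var 0)))
  (If (Digit (add_const 1 Const_Atom))
    (If (Digit (add_const 2 Const_Atom)) (Digit (add_const 3 Const_Atom)) Const_Atom) Const_Atom)
  e_true"

text \<open>Both sample sizes are powers of 2, so that only exponents have to be added up. The value
  \<open>e_true\<close> is a pair of two atoms: in the vote it stands for two zero counters, in the
  elimination for an empty mask and an empty list of variables.\<close>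

definition "f_main c = If f_easy
  (Mk_Pair Const_Atom (Call 18 (Mk_Pair
    (Call 8 (Mk_Pair (Fst (Var 0)) (Call 3 (add_const (c + 2) (Call 5 (Fst (Var 0)))))))
    e_true)))
  (Let (Call 5 (Snd (Var 0)))
  (Let (Call 8 (Mk_Pair (Fst (Var 1)) (Call 3 (add_const (c + 2)
      (Call 1 (Mk_Pair (Call 6 (add_const 1 Const_Atom))
        (Call 1 (Mk_Pair (Call 5 (Fst (Var 1))) (Call 2 (Mk_Pair (Var 0) (Var 0)))))))))))
    (Call 16 (Mk_Pair (Var 1) (Mk_Pair
      (Call 12 (Mk_Pair (Var 0) (Mk_Pair (Fst (Var 2)) e_true)))
      (Var 0))))))"

definition prog :: "nat \<Rightarrow> program" where
  "prog c = [f_main c, f_append, f_mul, f_pow2, f_half, f_bit_length, f_first_digit, f_point, f_sample,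
     f_band, f_pad, f_agrees, f_elim, f_all, f_nth, f_split, f_search, f_search_split, f_majority, f_greater]"


section \<open>Evaluation with time bounds\<close>

fun bit_length :: "nat \<Rightarrow> nat" where
  "bit_length 0 = 0"
| "bit_length (Suc k) = Suc (bit_length (Suc k div 2))"

type_synonym sample = "(bool list \<times> bool) list"

definition band :: "bool list \<Rightarrow> bool list \<Rightarrow> bool list" where
  "band x m = map2 (\<and>) x m"

definition agrees :: "(bool list \<Rightarrow> int) \<Rightarrow> sample \<Rightarrow> bool list \<Rightarrow> bool" where
  "agrees f S m \<longleftrightarrow> (\<forall>(x, y)\<in>set S. (f (band x m) = 1) = y)"

primrec elim_vars :: "(bool list \<Rightarrow> int) \<Rightarrow> sample \<Rightarrow> nat \<Rightarrow> bool list \<Rightarrow> nat list \<Rightarrow> nat list" where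
  "elim_vars f S 0 m V = V"
| "elim_vars f S (Suc k) m V =
     (if agrees f S (replicate k True @ False # m) then elim_vars f S k (False # m) V
      else elim_vars f S k (True # m) (k # V))"

definition split_sample :: "nat \<Rightarrow> bool \<Rightarrow> sample \<Rightarrow> sample" where
  "split_sample i b S = filter (\<lambda>(x, y). x ! i = b) S"

definition all_labels :: "bool \<Rightarrow> sample \<Rightarrow> bool" where
  "all_labels b S \<longleftrightarrow> (\<forall>(x, y)\<in>set S. y = b)"

text \<open>\<open>D\<close> holds the variables rejected as roots, \<open>W\<close> those still to
  be tried. Rejection only concerns the root with the reduced budget, so the subtrees may use all of
  \<open>D @ W\<close>.\<close>

function search :: "nat \<Rightarrow> nat list \<Rightarrow> sample \<Rightarrow> dtree option"
  and search_split :: "nat \<Rightarrow> sample \<Rightarrow> nat list \<Rightarrow> nat list \<Rightarrow> dtree option" where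
  "search r V S = (if all_labels True S then Some (Leaf 1)
     else if all_labels False S then Some (Leaf (-1))
     else if r = 0 then None else search_split r S [] V)"
| "search_split r S D [] = None"
| "search_split r S D (i # W) =
    (let a = search (r - 1) (D @ W) (split_sample i False S);
         b = search (r - 1) (D @ W) (split_sample i True S)
     in if a = None \<and> b = None then search_split r S (i # D) W
        else let a' = (if a = None then search r (D @ W) (split_sample i False S) else a);
                 b' = (if b = None then search r (D @ W) (split_sample i True S) else b)
             in (case a' of None \<Rightarrow> None | Some l \<Rightarrow> map_option (Node i l) b'))"
  by pat_completeness auto
termination
  \<comment> \<open>The number of available variables drops when a root is chosen. While it stays
    equal, \<open>search\<close> ranks above \<open>search_split\<close>, and a rejected candidate
    shortens \<open>W\<close>.\<close>
  by (relation "measures [\<lambda>z. case z of Inl (r, V, S) \<Rightarrow> length V | Inr (r, S, D, W) \<Rightarrow> length D + length W,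
        \<lambda>z. case z of Inl (r, V, S) \<Rightarrow> Suc (length V) | Inr (r, S, D, W) \<Rightarrow> length W]") auto

declare search.simps [simp del] search_split.simps [simp del]

section \<open>Encodings of lists, samples and results\<close>

primrec vlist :: "val list \<Rightarrow> val" where
  "vlist [] = Atom"
| "vlist (v # vs) = Pair v (vlist vs)"

definition enc_sample :: "sample \<Rightarrow> val" where
  "enc_sample S = vlist (map (\<lambda>(x, y). Pair (enc_bits x) (enc_bool y)) S)"

text \<open>Encoded trees are pairs, so \<open>Atom\<close> is free to stand for failure.\<close>

definition enc_opt :: "dtree option \<Rightarrow> val" where
  "enc_opt z = (case z of None \<Rightarrow> Atom | Some t \<Rightarrow> enc_dtree t)"

lemma enc_sample_simps [simp]:
  "enc_sample [] = Atom"
  "enc_sample ((x, y) # S) = Pair (Pair (enc_bits x) (enc_bool y)) (enc_sample S)"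
  by (simp_all add: enc_sample_def)

lemma enc_opt_simps [simp]: "enc_opt None = Atom" "enc_opt (Some t) = enc_dtree t"
  by (simp_all add: enc_opt_def)

lemma enc_eq_Atom [simp]:
  "enc_dtree t \<noteq> Atom" "enc_opt z = Atom \<longleftrightarrow> z = None" "enc_bool b = Atom \<longleftrightarrow> \<not> b"
  "enc_nat k = Atom \<longleftrightarrow> k = 0" "enc_bits x = Atom \<longleftrightarrow> x = []" "vlist vs = Atom \<longleftrightarrow> vs = []"
  "enc_sample S = Atom \<longleftrightarrow> S = []"
proof -
  show *: "enc_dtree t \<noteq> Atom" for t by (cases t) auto
  show "enc_opt z = Atom \<longleftrightarrow> z = None" by (cases z) (auto simp: *)
  show "enc_bool b = Atom \<longleftrightarrow> \<not> b" by (simp add: enc_bool_def)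
  show "enc_nat k = Atom \<longleftrightarrow> k = 0" by (cases k) auto
  show "enc_bits x = Atom \<longleftrightarrow> x = []" by (cases x) auto
  show "vlist vs = Atom \<longleftrightarrow> vs = []" by (cases vs) auto
  show "enc_sample S = Atom \<longleftrightarrow> S = []" by (cases S) auto
qed

lemma enc_bool_simps [simp]: "enc_bool True = Pair Atom Atom" "enc_bool False = Atom"
  by (simp_all add: enc_bool_def)

lemma enc_nat_conv_vlist: "enc_nat k = vlist (replicate k Atom)"
  by (induction k) auto

text \<open>Otherwise the simplifier rewrites the index of function 1 and the specifications of its calls
  no longer match.\<close>

declare One_nat_def [simp del]

lemma enc_nat_1 [simp]: "enc_nat 1 = Pair Atom Atom"
  by (simp add: One_nat_def)

section \<open>Compositional evaluation with upper time bounds\<close>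

context
  fixes c n :: nat and f :: "bool list \<Rightarrow> int" and \<epsilon> :: real
begin

text \<open>\<open>B\<close> bounds the time only from above, so branches of different cost can
  share one bound and bounds can be rounded up at every call.\<close>

definition evals :: "val list \<Rightarrow> bool list \<Rightarrow> expr \<Rightarrow> val \<Rightarrow> bool list \<Rightarrow> nat \<Rightarrow> bool" where
  "evals env r e v r' B \<longleftrightarrow> (\<exists>t\<le>B. eval (prog c) n f \<epsilon> env r e v r' t)"

definition calls :: "nat \<Rightarrow> val \<Rightarrow> bool list \<Rightarrow> val \<Rightarrow> bool list \<Rightarrow> nat \<Rightarrow> bool" where
  "calls j u r v r' B \<longleftrightarrow> j < length (prog c) \<and> evals [u] r (prog c ! j) v r' B"

lemma calls_weaken: "calls j u r v' r'' B' \<Longrightarrow> v' = v \<Longrightarrow> r'' = r' \<Longrightarrow> B' \<le> B \<Longrightarrow> calls j u r v r' B"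
  unfolding calls_def evals_def by (auto intro: order_trans)

lemma evals_weaken: "evals env r e v' r'' B' \<Longrightarrow> v' = v \<Longrightarrow> r'' = r' \<Longrightarrow> B' \<le> B \<Longrightarrow> evals env r e v r' B"
  unfolding evals_def by (auto intro: order_trans)

lemma evals_Var: "i < length env \<Longrightarrow> evals env r (Var i) (env ! i) r 1"
  unfolding evals_def by (metis eval.Var order_refl)

lemma evals_Const_Atom: "evals env r Const_Atom Atom r 1"
  unfolding evals_def by (metis eval.Const_Atom order_refl)

lemma evals_Mk_Pair: "evals env r a u r1 t1 \<Longrightarrow> evals env r1 b v r2 t2 \<Longrightarrow>
    evals env r (Mk_Pair a b) (Pair u v) r2 (t1 + t2 + 1)"
  unfolding evals_def by (meson add_le_mono eval.Mk_Pair order_refl)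

lemma evals_Fst: "evals env r a v r1 t \<Longrightarrow> evals env r (Fst a) (val_fst v) r1 (t + 1)"
  unfolding evals_def by (meson add_le_mono eval.Fst order_refl)

lemma evals_Snd: "evals env r a v r1 t \<Longrightarrow> evals env r (Snd a) (val_snd v) r1 (t + 1)"
  unfolding evals_def by (meson add_le_mono eval.Snd order_refl)

text \<open>One rule serves both branches: once the value of the guard is known, simplification
  selects the branch.\<close>

lemma evals_If: "evals env r e u r1 t1 \<Longrightarrow> evals env r1 (if u = Atom then b else a) v r2 t2 \<Longrightarrow>
    evals env r (If e a b) v r2 (t1 + t2 + 1)"
  unfolding evals_def
  apply (elim exE conjE)
  subgoal for t t'
    by (rule exI[of _ "t + t' + 1"])
      (cases "u = Atom"; simp add: eval.If_false[simplified] eval.If_true[simplified])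
  done

lemma evals_Let: "evals env r a u r1 t1 \<Longrightarrow> evals (u # env) r1 b v r2 t2 \<Longrightarrow>
    evals env r (Let a b) v r2 (t1 + t2 + 1)"
  unfolding evals_def by (meson add_le_mono eval.Let order_refl)

lemma evals_Call: "evals env r a u r1 t1 \<Longrightarrow> calls j u r1 v r2 t2 \<Longrightarrow>
    evals env r (Call j a) v r2 (t1 + t2 + 1)"
  unfolding evals_def calls_def by (meson add_le_mono eval.Call order_refl)

lemma evals_Flip: "evals env (b # r) Flip (enc_bool b) r 1"
  unfolding evals_def by (metis eval.Flip order_refl)

lemma evals_Query: "evals env r a v r1 t \<Longrightarrow> v = enc_bits x \<Longrightarrow> length x = n \<Longrightarrow>
    evals env r (Query a) (enc_bool (f x = 1)) r1 (t + n + 1)"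
  unfolding evals_def by (metis (mono_tags, lifting) add_le_mono eval.Query order_refl cube_def
    mem_Collect_eq enc_sign_def)

lemma evals_Digit: "evals env r a v r1 t \<Longrightarrow> v = enc_nat k \<Longrightarrow>
    evals env r (Digit a) (enc_bool (digit \<epsilon> k)) r1 (t + k + 1)"
  unfolding evals_def by (metis add_le_mono eval.Digit order_refl)

text \<open>\<open>b\<close> occurs in both branches of \<open>e_iff\<close>, but only one copy is
  evaluated, so its time counts once. The constant 5 covers the two conditionals and a constant
  pair.\<close>

lemma evals_iff: "evals env r a u r1 t1 \<Longrightarrow> u = enc_bool y \<Longrightarrow> evals env r1 b v r1 t2 \<Longrightarrow> v = enc_bool z \<Longrightarrow>
    evals env r (e_iff a b) (enc_bool (y = z)) r1 (t1 + t2 + 5)"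
proof -
  assume a: "evals env r a u r1 t1" "u = enc_bool y" and b: "evals env r1 b v r1 t2" "v = enc_bool z"
  have neg: "evals env r1 (If b Const_Atom e_true) (enc_bool (\<not> z)) r1 (t2 + 4)"
  proof (cases z)
    case True
    then show ?thesis using b(2)
      by (intro evals_weaken[OF evals_If [OF b(1)]]) (simp_all, (rule evals_Const_Atom | simp)+)
  next
    case False
    then show ?thesis using b(2)
      by (intro evals_weaken[OF evals_If [OF b(1)]])
        (simp_all, (rule evals_Const_Atom evals_Mk_Pair)+, simp_all)
  qed
  have "evals env r1 (if u = Atom then If b Const_Atom e_true else b) (enc_bool (y = z)) r1 (t2 + 4)"
    using a(2) b neg by (auto intro: evals_weaken)
  from evals_If [OF a(1) this] show ?thesis
    by (rule evals_weaken) simp_all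
qed

text \<open>The order matters: \<open>e_iff\<close> abbreviates a conditional, so
  \<open>evals_iff\<close> has to be tried before \<open>evals_If\<close>.\<close>

lemmas evals_rules = evals_iff evals_Var evals_Const_Atom evals_Mk_Pair evals_Fst evals_Snd evals_If evals_Let evals_Call evals_Flip evals_Query refl

text \<open>Result, tape and bound of the body enter as schematic variables that the evaluation
  rules instantiate; comparing them with the specification is left to the end.\<close>

lemma callsI: "prog c ! j = e \<Longrightarrow> j < 20 \<Longrightarrow> evals [u] r e v' r'' B' \<Longrightarrow> v' = v \<Longrightarrow> r'' = r' \<Longrightarrow> B' \<le> B \<Longrightarrow>
    calls j u r v r' B"
  unfolding calls_def using evals_weaken by (simp add: prog_def)

lemma prog_nth:
  "prog c ! 0 = f_main c" "prog c ! 1 = f_append" "prog c ! 2 = f_mul" "prog c ! 3 = f_pow2"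
  "prog c ! 4 = f_half" "prog c ! 5 = f_bit_length" "prog c ! 6 = f_first_digit" "prog c ! 7 = f_point"
  "prog c ! 8 = f_sample" "prog c ! 9 = f_band" "prog c ! 10 = f_pad" "prog c ! 11 = f_agrees"
  "prog c ! 12 = f_elim" "prog c ! 13 = f_all" "prog c ! 14 = f_nth" "prog c ! 15 = f_split"
  "prog c ! 16 = f_search" "prog c ! 17 = f_search_split" "prog c ! 18 = f_majority"
  "prog c ! 19 = f_greater"
  by (simp_all add: prog_def)

section \<open>Arithmetic, bit lengths and digits\<close>

lemma calls_append: "calls 1 (Pair (vlist xs) (vlist ys)) r (vlist (xs @ ys)) r (20 * length xs + 20)"
proof (induction xs)
  case Nil
  show ?case
    by (rule callsI, rule prog_nth, simp, unfold f_append_def)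
      ((rule evals_rules | simp)+)
next
  case (Cons x xs)
  show ?case
    by (rule callsI, rule prog_nth, simp, unfold f_append_def)
      ((rule evals_rules Cons.IH | simp)+)
qed

text \<open>A unary number is a list of atoms, so concatenation adds.\<close>

lemma calls_add: "calls 1 (Pair (enc_nat a) (enc_nat b)) r (enc_nat (a + b)) r (20 * a + 20)"
  using calls_append[of "replicate a Atom" "replicate b Atom" r]
  by (simp add: enc_nat_conv_vlist replicate_add)

lemma calls_mul: "calls 2 (Pair (enc_nat a) (enc_nat b)) r (enc_nat (a * b)) r (40 * a * (b + 1) + 20)"
proof (induction a)
  case 0
  show ?case
    by (rule callsI, rule prog_nth, simp, unfold f_mul_def)
      ((rule evals_rules | simp)+)
next
  case (Suc a)
  show ?case
    by (rule callsI, rule prog_nth, simp, unfold f_mul_def)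
      ((rule evals_rules Suc.IH calls_add | simp add: algebra_simps)+)
qed

text \<open>Each doubling costs time linear in the value, and the geometric series sums to a
  multiple of the result.\<close>

lemma calls_pow2: "calls 3 (enc_nat k) r (enc_nat (2 ^ k)) r (100 * 2 ^ k)"
proof (induction k)
  case 0
  show ?case
    by (rule callsI, rule prog_nth, simp, unfold f_pow2_def)
      ((rule evals_rules  | simp)+)
next
  case (Suc k)
  show ?case
    by (rule callsI, rule prog_nth, simp, unfold f_pow2_def)
      ((rule evals_rules Suc.IH calls_add | simp add: mult_2
        | (insert one_le_power[of "2::nat" k], linarith))+)
qed

lemma calls_half: "calls 4 (enc_nat k) r (enc_nat (k div 2)) r (20 * k + 20)"
proof (induction k rule: induct_nat_012)
  case 0
  show ?case
    by (rule callsI, rule prog_nth, simp, unfold f_half_def)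
      ((rule evals_rules  | simp)+)
next
  case 1
  show ?case
    by (rule callsI, rule prog_nth, simp, unfold f_half_def)
      ((rule evals_rules  | simp)+)
next
  case (ge2 k)
  show ?case
    by (rule callsI, rule prog_nth, simp, unfold f_half_def)
      ((rule evals_rules ge2.IH(1) | simp)+)
qed

text \<open>The cost of halving shrinks geometrically with the value, so the total stays
  linear.\<close>

lemma calls_bit_length: "calls 5 (enc_nat k) r (enc_nat (bit_length k)) r (100 * k + 20)"
proof (induction k rule: bit_length.induct)
  case 1
  show ?case
    by (rule callsI, rule prog_nth, simp, unfold f_bit_length_def)
      ((rule evals_rules  | simp)+)
next
  case (2 k)
  have *: "calls 4 (Pair Atom (enc_nat k)) r (enc_nat (Suc k div 2)) r (20 * k + 40)"
    by (rule calls_weaken, rule calls_half[of "Suc k", simplified]) simp_all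
  have **: "100 * (Suc k div 2) \<le> 50 * k + 50" by linarith
  show ?case
    using ** by - (rule callsI, rule prog_nth, simp, unfold f_bit_length_def,
      (rule evals_rules 2 * | simp)+)
qed

lemma calls_first_digit:
  assumes "digit \<epsilon> (k + d)" "\<And>i. i < d \<Longrightarrow> \<not> digit \<epsilon> (k + i)"
  shows "calls 6 (enc_nat k) r (enc_nat (k + d)) r ((d + 1) * (k + d + 20))"
  using assms
proof (induction d arbitrary: k)
  case 0
  then show ?case
    by - (rule callsI, rule prog_nth, simp, unfold f_first_digit_def,
      (rule evals_rules evals_Digit | simp)+)
next
  case (Suc d)
  have IH: "calls 6 (Pair Atom (enc_nat k)) r (enc_nat (Suc k + d)) r ((d + 1) * (Suc k + d + 20))"
    using Suc.IH[of "Suc k"] Suc.prems(1) Suc.prems(2)[of "Suc i" for i] by simp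
  have "\<not> digit \<epsilon> k" using Suc.prems(2)[of 0] by simp
  then show ?case
    by - (rule callsI, rule prog_nth, simp, unfold f_first_digit_def,
      (rule evals_rules evals_Digit IH | simp)+)
qed

section \<open>Drawing the sample\<close>

lemma calls_point: "calls 7 (enc_nat (length x)) (x @ r) (enc_bits x) r (20 * length x + 20)"
proof (induction x)
  case Nil
  show ?case
    by (rule callsI, rule prog_nth, simp, unfold f_point_def)
      ((rule evals_rules  | simp)+)
next
  case (Cons b x)
  show ?case
    by (rule callsI, rule prog_nth, simp, unfold f_point_def)
      ((rule evals_rules Cons.IH | simp)+)
qed

text \<open>Writing the tape as \<open>concat xs @ r\<close> exposes the points drawn as a list;
  this is how uniform coins later become uniform samples.\<close>

lemma calls_sample:
  assumes "\<forall>x\<in>set xs. length x = n"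
  shows "calls 8 (Pair (enc_nat n) (enc_nat (length xs))) (concat xs @ r)
    (enc_sample (map (\<lambda>x. (x, f x = 1)) xs)) r ((50 * n + 60) * (length xs + 1))"
  using assms
proof (induction xs)
  case Nil
  show ?case
    by (rule callsI, rule prog_nth, simp, unfold f_sample_def)
      ((rule evals_rules  | simp)+)
next
  case (Cons x xs)
  have IH: "calls 8 (Pair (enc_nat n) (enc_nat (length xs))) (concat xs @ r)
    (enc_sample (map (\<lambda>x. (x, f x = 1)) xs)) r ((50 * n + 60) * (length xs + 1))"
    using Cons by simp
  have x: "length x = n" using Cons.prems by simp
  have pt: "calls 7 (enc_nat n) (x @ concat xs @ r) (enc_bits x) (concat xs @ r) (20 * n + 20)"
    using calls_point[of x] x by simp
  show ?case using x
    by - (rule callsI, rule prog_nth, simp, unfold f_sample_def,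
      (rule evals_rules pt IH | simp)+)
qed

section \<open>Masks and elimination\<close>

lemma calls_band:
  "length m = length x \<Longrightarrow>
   calls 9 (Pair (enc_bits x) (enc_bits m)) r (enc_bits (band x m)) r (30 * length x + 20)"
proof (induction x m rule: list_induct2')
  case 1
  show ?case unfolding band_def
    by (rule callsI, rule prog_nth, simp, unfold f_band_def)
      ((rule evals_rules  | simp)+)
next
  case (4 a x b m)
  have IH: "calls 9 (Pair (enc_bits x) (enc_bits m)) r (enc_bits (band x m)) r (30 * length x + 20)"
    using 4 by simp
  show ?case
  proof (cases a)
    case True
    then show ?thesis
      by - (rule callsI, rule prog_nth, simp, unfold f_band_def,
        (rule evals_rules IH | simp add: band_def)+)
  next
    case False
    then show ?thesis
      by - (rule callsI, rule prog_nth, simp, unfold f_band_def,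
        (rule evals_rules IH | simp add: band_def)+)
  qed
qed simp_all

lemma calls_pad:
  "calls 10 (Pair (enc_nat k) (enc_bits m)) r (enc_bits (replicate k True @ m)) r (30 * k + 20)"
proof (induction k arbitrary: m)
  case 0
  show ?case
    by (rule callsI, rule prog_nth, simp, unfold f_pad_def)
      ((rule evals_rules  | simp)+)
next
  case (Suc k)
  show ?case
    by (rule callsI, rule prog_nth, simp, unfold f_pad_def)
      ((rule evals_rules Suc.IH[of "True # m", simplified] | simp add: replicate_app_Cons_same)+)
qed

lemma calls_agrees:
  assumes "\<forall>(x, y)\<in>set S. length x = n" "length m = n"
  shows "calls 11 (Pair (enc_sample S) (enc_bits m)) r (enc_bool (agrees f S m)) r
    ((40 * n + 60) * (length S + 1))"
  using assms(1)
proof (induction S)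
  case Nil
  show ?case
    by - (rule callsI, rule prog_nth, simp, unfold f_agrees_def,
      (rule evals_rules  | simp add: agrees_def)+)
next
  case (Cons z S)
  obtain x y where z: "z = (x, y)" by force
  have x: "length x = n" using Cons.prems z by simp
  have IH: "calls 11 (Pair (enc_sample S) (enc_bits m)) r (enc_bool (agrees f S m)) r
    ((40 * n + 60) * (length S + 1))"
    using Cons by simp
  have band: "calls 9 (Pair (enc_bits x) (enc_bits m)) r (enc_bits (band x m)) r (30 * n + 20)"
    using calls_band[of m x] x assms(2) by simp
  have len: "length (band x m) = n" using x assms(2) by (simp add: band_def)
  show ?case
  proof (cases "(f (band x m) = 1) = y")
    case True
    then show ?thesis unfolding z using len
    by - (rule callsI, rule prog_nth, simp, unfold f_agrees_def,
      (rule evals_rules band IH | simp add: agrees_def)+)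
  next
    case False
    then show ?thesis unfolding z using len
    by - (rule callsI, rule prog_nth, simp, unfold f_agrees_def,
      (rule evals_rules band IH | simp add: agrees_def)+)
  qed
qed

text \<open>Each coordinate costs one agreement test, which is linear in the sample. The condition
  \<open>k + length m = n\<close> keeps the padded masks at length \<open>n\<close>, so that all
  queries are well-formed.\<close>

lemma calls_elim:
  assumes "\<forall>(x, y)\<in>set S. length x = n"
  shows "k + length m = n \<Longrightarrow>
    calls 12 (Pair (enc_sample S) (Pair (enc_nat k) (Pair (enc_bits m) (vlist (map enc_nat V))))) r
    (vlist (map enc_nat (elim_vars f S k m V))) r
    ((100 * n + 200) * (length S + 1) * (k + 1))"
proof (induction k arbitrary: m V)
  case 0
  show ?case
    by - (rule callsI, rule prog_nth, simp, unfold f_elim_def,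
      (rule evals_rules | simp add: algebra_simps)+)
next
  case (Suc k)
  have pad: "calls 10 (Pair (enc_nat k) (Pair Atom (enc_bits m))) r
      (enc_bits (replicate k True @ False # m)) r (30 * n + 20)"
    by (rule calls_weaken, rule calls_pad[of _ "False # m", simplified]) (use Suc.prems in simp_all)
  have agr: "calls 11 (Pair (enc_sample S) (enc_bits (replicate k True @ False # m))) r
      (enc_bool (agrees f S (replicate k True @ False # m))) r ((40 * n + 60) * (length S + 1))"
    by (rule calls_agrees) (use assms Suc.prems in auto)
  have IH1: "calls 12 (Pair (enc_sample S) (Pair (enc_nat k) (Pair (Pair Atom (enc_bits m))
        (vlist (map enc_nat V))))) r
      (vlist (map enc_nat (elim_vars f S k (False # m) V))) r
      ((100 * n + 200) * (length S + 1) * (k + 1))"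
    using Suc.IH[of "False # m" V] Suc.prems by simp
  have IH2: "calls 12 (Pair (enc_sample S) (Pair (enc_nat k) (Pair (Pair (Pair Atom Atom) (enc_bits m))
        (Pair (enc_nat k) (vlist (map enc_nat V)))))) r
      (vlist (map enc_nat (elim_vars f S k (True # m) (k # V)))) r
      ((100 * n + 200) * (length S + 1) * (k + 1))"
    using Suc.IH[of "True # m" "k # V"] Suc.prems by simp
  show ?case
  proof (cases "agrees f S (replicate k True @ False # m)")
    case True
    then show ?thesis
    by - (rule callsI, rule prog_nth, simp, unfold f_elim_def,
      (rule evals_rules pad agr IH1 | simp add: algebra_simps)+)
  next
    case False
    then show ?thesis
    by - (rule callsI, rule prog_nth, simp, unfold f_elim_def,
      (rule evals_rules pad agr IH2 | simp add: algebra_simps)+)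
  qed
qed

section \<open>Labels, coordinates and halves of a sample\<close>

lemma calls_all:
  "calls 13 (Pair (enc_sample S) (enc_bool b)) r (enc_bool (all_labels b S)) r (40 * length S + 20)"
proof (induction S)
  case Nil
  show ?case
    by - (rule callsI, rule prog_nth, simp, unfold f_all_def,
      (rule evals_rules  | simp add: all_labels_def)+)
next
  case (Cons z S)
  obtain x y where z: "z = (x, y)" by force
  show ?case
  proof (cases "y = b")
    case True
    then show ?thesis unfolding z
    by - (rule callsI, rule prog_nth, simp, unfold f_all_def,
      (rule evals_rules Cons.IH | simp add: all_labels_def)+)
  next
    case False
    then show ?thesis unfolding z
    by - (rule callsI, rule prog_nth, simp, unfold f_all_def,
      (rule evals_rules Cons.IH | simp add: all_labels_def)+)
  qed
qed

lemma calls_nth: "i < length x \<Longrightarrow>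
  calls 14 (Pair (enc_bits x) (enc_nat i)) r (enc_bool (x ! i)) r (20 * i + 20)"
proof (induction i arbitrary: x)
  case 0
  then obtain a y where "x = a # y" by (cases x) auto
  then show ?case
    by - (rule callsI, rule prog_nth, simp, unfold f_nth_def,
      (rule evals_rules  | simp)+)
next
  case (Suc i)
  then obtain a y where y: "x = a # y" by (cases x) auto
  then have "i < length y" using Suc.prems by simp
  from Suc.IH[OF this] show ?case unfolding y
    by - (rule callsI, rule prog_nth, simp, unfold f_nth_def,
      (rule evals_rules | assumption | simp)+)
qed

lemma calls_split:
  assumes "i < n"
  shows "\<forall>(x, y)\<in>set S. length x = n \<Longrightarrow>
    calls 15 (Pair (enc_sample S) (Pair (enc_nat i) (enc_bool b))) r
      (enc_sample (split_sample i b S)) r ((20 * n + 70) * (length S + 1))"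
proof (induction S)
  case Nil
  show ?case
    by - (rule callsI, rule prog_nth, simp, unfold f_split_def,
      (rule evals_rules  | simp add: split_sample_def)+)
next
  case (Cons z S)
  obtain x y where z: "z = (x, y)" by force
  have x: "length x = n" using Cons.prems z by simp
  have IH: "calls 15 (Pair (enc_sample S) (Pair (enc_nat i) (enc_bool b))) r
      (enc_sample (split_sample i b S)) r ((20 * n + 70) * (length S + 1))"
    using Cons by simp
  have nth: "calls 14 (Pair (enc_bits x) (enc_nat i)) r (enc_bool (x ! i)) r (20 * n + 20)"
    by (rule calls_weaken, rule calls_nth) (use assms x in simp_all)
  show ?case
  proof (cases "x ! i = b")
    case True
    then show ?thesis unfolding z
    by - (rule callsI, rule prog_nth, simp, unfold f_split_def,
      (rule evals_rules nth IH | simp add: split_sample_def)+)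
  next
    case False
    then show ?thesis unfolding z
    by - (rule callsI, rule prog_nth, simp, unfold f_split_def,
      (rule evals_rules nth IH | simp add: split_sample_def)+)
  qed
qed

section \<open>Counting votes\<close>

lemma calls_greater: "calls 19 (Pair (enc_nat a) (enc_nat b)) r (enc_bool (a > b)) r (20 * a + 20)"
proof (induction a arbitrary: b)
  case 0
  show ?case
    by - (rule callsI, rule prog_nth, simp, unfold f_greater_def,
      (rule evals_rules  | simp)+)
next
  case (Suc a)
  show ?case
  proof (cases b)
    case 0
    then show ?thesis
    by - (rule callsI, rule prog_nth, simp, unfold f_greater_def,
      (rule evals_rules  | simp)+)
  next
    case (Suc b')
    then show ?thesis
    by - (rule callsI, rule prog_nth, simp, unfold f_greater_def,
      (rule evals_rules Suc.IH | simp)+)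
  qed
qed

lemma calls_majority: "calls 18 (Pair (enc_sample S) (Pair (enc_nat a) (enc_nat b))) r
    (enc_bool (a + length (filter snd S) > b + length (filter (Not \<circ> snd) S))) r
    (50 * length S + 20 * a + 50)"
proof (induction S arbitrary: a b)
  case Nil
  show ?case
    by - (rule callsI, rule prog_nth, simp, unfold f_majority_def,
      (rule evals_rules calls_greater | simp)+)
next
  case (Cons z S)
  obtain x y where z: "z = (x, y)" by force
  show ?case
  proof (cases y)
    case True
    then show ?thesis unfolding z
    by - (rule callsI, rule prog_nth, simp, unfold f_majority_def,
      (rule evals_rules Cons.IH[of "Suc a" b, simplified] | simp)+)
  next
    case False
    then show ?thesis unfolding z
    by - (rule callsI, rule prog_nth, simp, unfold f_majority_def,
      (rule evals_rules Cons.IH[of a "Suc b", simplified] | simp)+)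
  qed
qed


section \<open>The cost of the search\<close>

context
  fixes s M :: nat
begin

definition level_cost where "level_cost = 1000 * (M + 1) * (n + 1) * (s + 1)"

text \<open>One half pays for the label tests in \<open>search\<close>, one half for each candidate
  tried in \<open>search_split\<close>.\<close>

lemma level_cost_half: "level_cost = 2 * (level_cost div 2)" "level_cost div 2 = 500 * ((M + 1) * (n + 1) * (s + 1))"
proof -
  have "level_cost = 2 * (500 * ((M + 1) * (n + 1) * (s + 1)))" by (simp add: level_cost_def)
  then show "level_cost = 2 * (level_cost div 2)" "level_cost div 2 = 500 * ((M + 1) * (n + 1) * (s + 1))" by simp_all
qed

text \<open>A closed form above the recurrence in which a node with \<open>v\<close> variables makes
  at most \<open>2 * v\<close> searches with one unit of budget less and one search with the same
  budget, all with \<open>v - 1\<close> variables.\<close>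

definition search_time :: "nat \<Rightarrow> nat \<Rightarrow> nat" where
  "search_time r v = level_cost * (v + 1) * (4 * (s + 1)\<^sup>2) ^ r"

definition fits_size :: "sample \<Rightarrow> bool" where
  "fits_size S \<longleftrightarrow> length S \<le> M \<and> (\<forall>(x, y)\<in>set S. length x = n)"

lemma fits_size_split: "fits_size S \<Longrightarrow> fits_size (split_sample i b S)"
  unfolding fits_size_def split_sample_def by (auto intro: order_trans[OF length_filter_le])

text \<open>The full budget is spent at most once: when one of the two cheap searches succeeds, only
  the other can need repetition, and the scan ends there. So each candidate is charged two cheap
  searches, and one full search is added overall. The assumption \<open>search\<close> is the
  induction hypothesis of \<open>calls_search\<close>.\<close>

lemma calls_search_split:
  assumes search: "\<And>r V S tp. length V < v \<Longrightarrow> set V \<subseteq> {..<n} \<Longrightarrow> fits_size S \<Longrightarrow>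
      calls 16 (Pair (enc_nat r) (Pair (vlist (map enc_nat V)) (enc_sample S))) tp
        (enc_opt (search r V S)) tp (search_time r (length V))"
    and "fits_size S" "v \<le> s"
  shows "length D + length W = v \<Longrightarrow> set D \<union> set W \<subseteq> {..<n} \<Longrightarrow>
    calls 17 (Pair (enc_nat (Suc r)) (Pair (enc_sample S)
        (Pair (vlist (map enc_nat D)) (vlist (map enc_nat W))))) tp
      (enc_opt (search_split (Suc r) S D W)) tp
      (length W * (level_cost div 2 + 2 * search_time r (v - 1)) + 10
        + (if W = [] then 0 else search_time (Suc r) (v - 1)))"
proof (induction W arbitrary: D)
  case Nil
  show ?case
    by - (rule callsI, rule prog_nth, simp, unfold f_search_split_def,
      (rule evals_rules | simp add: search_split.simps)+)
next
  case (Cons i W)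
  let ?R = "D @ W"
  let ?S0 = "split_sample i False S" and ?S1 = "split_sample i True S"
  have R: "length ?R < v" "length ?R = v - 1" "set ?R \<subseteq> {..<n}" and i: "i < n" using Cons.prems by auto
  have app: "calls 1 (Pair (vlist (map enc_nat D)) (vlist (map enc_nat W))) tp
      (vlist (map enc_nat ?R)) tp (20 * s + 20)"
    by (rule calls_weaken, rule calls_append) (use Cons.prems assms(3) in simp_all)
  define Q where "Q = (20 * n + 70) * (M + 1)"
  have split: "calls 15 (Pair (enc_sample S) (Pair (enc_nat i) (enc_bool b))) tp
      (enc_sample (split_sample i b S)) tp Q" for b
    by (rule calls_weaken, rule calls_split[OF i])
      (use \<open>fits_size S\<close> in \<open>auto simp: Q_def fits_size_def intro!: mult_le_mono\<close>)
  note split0 = split[of False, simplified] and split1 = split[of True, simplified]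
  have srch: "calls 16 (Pair (enc_nat r') (Pair (vlist (map enc_nat ?R)) (enc_sample (split_sample i b S)))) tp
        (enc_opt (search r' ?R (split_sample i b S))) tp (search_time r' (v - 1))" for b r'
    using search[OF R(1) R(3) fits_size_split[OF \<open>fits_size S\<close>], of r' i b tp] R(2) by simp
  note srch_Suc = srch[of "Suc r", unfolded enc_nat.simps]
  have IH: "calls 17 (Pair (Pair Atom (enc_nat r)) (Pair (enc_sample S)
        (Pair (Pair (enc_nat i) (vlist (map enc_nat D))) (vlist (map enc_nat W))))) tp
      (enc_opt (search_split (Suc r) S (i # D) W)) tp
      (length W * (level_cost div 2 + 2 * search_time r (v - 1)) + 10
        + (if W = [] then 0 else search_time (Suc r) (v - 1)))"
    using Cons.IH[of "i # D"] Cons.prems by simp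
  \<comment> \<open>Local work per candidate: joining \<open>D\<close> and \<open>W\<close>, two
    splits of the sample, and a constant overhead.\<close>
  have B: "20 * s + 2 * Q + 150 \<le> level_cost div 2"
  proof -
    show ?thesis unfolding level_cost_half(2) Q_def by (simp add: algebra_simps)
  qed
  define a where "a = search r ?R ?S0"
  define b where "b = search r ?R ?S1"
  define a' where "a' = search (Suc r) ?R ?S0"
  define b' where "b' = search (Suc r) ?R ?S1"
  note sa = srch[of r False, folded a_def] and sb = srch[of r True, folded b_def]
   and sa' = srch_Suc[of False, folded a'_def] and sb' = srch_Suc[of True, folded b'_def]
  have eq: "search_split (Suc r) S D (i # W) =
     (if a = None \<and> b = None then search_split (Suc r) S (i # D) W
      else case (if a = None then a' else a) of None \<Rightarrow> None
        | Some l \<Rightarrow> map_option (Node i l) (if b = None then b' else b))"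
    by (simp only: search_split.simps Let_def diff_Suc_1 a_def b_def a'_def b'_def)
  show ?case
  proof (cases a; cases b)
    assume "a = None" "b = None"
    then show ?thesis using B
      by - (rule callsI, rule prog_nth, simp, unfold f_search_split_def,
       (rule evals_rules app split0 split1 sa sb IH | simp add: eq del: map_append)+)
  next
    fix ta tb assume "a = Some ta" "b = Some tb"
    then show ?thesis using B
      by - (rule callsI, rule prog_nth, simp, unfold f_search_split_def,
       (rule evals_rules app split0 split1 sa sb | simp add: eq del: map_append)+)
  next
    fix ta assume "a = Some ta" "b = None"
    then show ?thesis using B
      by - (cases b'; rule callsI, rule prog_nth, simp, unfold f_search_split_def,
       (rule evals_rules app split0 split1 sa sb sb' | simp add: eq del: map_append)+)
  next
    fix tb assume "a = None" "b = Some tb"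
    then show ?thesis using B
      by - (cases a'; rule callsI, rule prog_nth, simp, unfold f_search_split_def,
       (rule evals_rules app split0 split1 sa sb sa' | simp add: eq del: map_append)+)
  qed
qed


lemma one_le_search_factor: "1 \<le> (4 * (s + 1)\<^sup>2) ^ r"
proof -
  have "0 < (4 * (s + 1)\<^sup>2) ^ r" by simp
  then show ?thesis by linarith
qed

text \<open>The recurrence holds because \<open>v \<le> s\<close>: adding one variable raises the
  bound by a term with the full factor \<open>4 * (s + 1)\<^sup>2\<close>, which outweighs the
  \<open>2 * v\<close> cheap searches.\<close>

lemma search_time_Suc:
  assumes "v \<noteq> 0" "v \<le> s"
  shows "level_cost div 2 + 10 + v * (level_cost div 2 + 2 * search_time r (v - 1)) + search_time (Suc r) (v - 1)
    \<le> search_time (Suc r) v"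
proof -
  define Q where "Q = (4 * (s + 1)\<^sup>2) ^ r"
  have Q: "1 \<le> Q" unfolding Q_def by (rule one_le_search_factor)
  define h where "h = level_cost div 2"
  have B: "level_cost = 2 * h" "10 \<le> h" unfolding h_def using level_cost_half by simp_all
  have v: "v - 1 + 1 = v" using assms by simp
  have "v ^ 2 \<le> s ^ 2" using assms by (simp add: power_mono)
  \<comment> \<open>Divided by \<open>2 * h * Q\<close>, the cost to be paid is at most the
    left-hand side and the available increment is the right-hand side.\<close>
  then have "1 + v + 2 * (v * v) \<le> 4 * (s + 1)\<^sup>2"
    using assms by (simp add: power2_eq_square algebra_simps)
  then have "2 * h * Q * (1 + v + 2 * (v * v)) \<le> 2 * h * Q * (4 * (s + 1)\<^sup>2)"
    by (rule mult_left_mono) simp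
  moreover have "h * (2 + 2 * v) * 1 \<le> h * (2 + 2 * v) * Q" by (rule mult_left_mono[OF Q]) simp
  moreover have "0 \<le> v * h" by simp
  ultimately have "h + 10 + v * (h + 2 * (2 * h * v * Q)) \<le> 2 * h * Q * (4 * (s + 1)\<^sup>2)"
    using B(2) unfolding distrib_left distrib_right mult_1_right by (simp only: ac_simps)
  then show ?thesis
    unfolding search_time_def v power_Suc Q_def[symmetric] h_def[symmetric]
    unfolding B(1) by (simp add: algebra_simps)
qed

text \<open>Induction on the number of variables rather than on the budget, since a repeated search
  keeps the budget.\<close>

lemma calls_search:
  "length V \<le> s \<Longrightarrow> set V \<subseteq> {..<n} \<Longrightarrow> fits_size S \<Longrightarrow>
    calls 16 (Pair (enc_nat r) (Pair (vlist (map enc_nat V)) (enc_sample S))) tp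
      (enc_opt (search r V S)) tp (search_time r (length V))"
proof (induction "length V" arbitrary: r V S tp rule: less_induct)
  case less
  have all: "calls 13 (Pair (enc_sample S) (enc_bool b)) tp (enc_bool (all_labels b S)) tp
      (40 * M + 20)" for b
    by (rule calls_weaken, rule calls_all) (use less.prems in \<open>simp_all add: fits_size_def\<close>)
  note all1 = all[of True, simplified] and all0 = all[of False, simplified]
  have B: "80 * M + 90 \<le> level_cost div 2"
  proof -
    show ?thesis unfolding level_cost_half(2) by (simp add: algebra_simps)
  qed
  have "level_cost * 1 \<le> search_time r' (length V)" for r'
    unfolding search_time_def mult.assoc
    using mult_le_mono[OF _ one_le_search_factor, of 1 "length V + 1" r']
    by (intro mult_left_mono) simp_all
  then have B': "80 * M + 90 \<le> search_time r' (length V)" for r'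
    using B order_trans[of "level_cost div 2" level_cost] by (metis div_le_dividend le_trans mult.right_neutral)
  consider "all_labels True S" | "\<not> all_labels True S" "all_labels False S"
    | "\<not> all_labels True S" "\<not> all_labels False S" "r = 0"
    | r' where "\<not> all_labels True S" "\<not> all_labels False S" "r = Suc r'"
    by (cases r) auto
  then show ?case
  proof cases
    case 1
    then show ?thesis using B'[of r]
      by - (rule callsI, rule prog_nth, simp, unfold f_search_def,
        (rule evals_rules all1 all0 | simp add: search.simps enc_sign_def)+)
  next
    case 2
    then show ?thesis using B'[of r]
      by - (rule callsI, rule prog_nth, simp, unfold f_search_def,
        (rule evals_rules all1 all0 | simp add: search.simps enc_sign_def)+)
  next
    case 3
    then show ?thesis using B'[of r]
      by - (rule callsI, rule prog_nth, simp, unfold f_search_def,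
        (rule evals_rules all1 all0 | simp add: search.simps enc_sign_def)+)
  next
    case 4
    let ?v = "length V"
    define T where "T = ?v * (level_cost div 2 + 2 * search_time r' (?v - 1)) + 10
        + (if V = [] then 0 else search_time (Suc r') (?v - 1))"
    have sp: "calls 17 (Pair (Pair Atom (enc_nat r')) (Pair (enc_sample S)
        (Pair Atom (vlist (map enc_nat V))))) tp
      (enc_opt (search_split (Suc r') S [] V)) tp T"
      unfolding T_def using calls_search_split[where v = ?v and S = S and D = "[]" and W = V and r = r' and tp = tp]
        less by simp
    have "T + level_cost div 2 \<le> search_time r ?v"
    proof (cases "V = []")
      case True
      have "T + level_cost div 2 \<le> level_cost" unfolding T_def True using level_cost_half by simp
      also have "\<dots> = level_cost * 1" by simp
      also have "\<dots> \<le> search_time r ?v" by fact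
      finally show ?thesis .
    next
      case False
      then show ?thesis using search_time_Suc[of ?v r'] less.prems(1)
        by (simp add: T_def 4)
    qed
    then show ?thesis using 4 B
      by - (rule callsI, rule prog_nth, simp, unfold f_search_def,
        (rule evals_rules all1 all0 sp | simp add: search.simps enc_sign_def)+)
  qed
qed

end

section \<open>The main function in its two cases\<close>

lemma evals_add_const: "evals env r e u r' t \<Longrightarrow> u = enc_nat a \<Longrightarrow>
    evals env r (add_const j e) (enc_nat (j + a)) r' (t + 2 * j)"
proof (induction j)
  case (Suc j)
  then show ?case
    by - (rule evals_weaken, simp only: add_const.simps, (rule evals_rules | simp)+)
qed (simp add: add_const.simps)

lemma evals_const: "evals env r (add_const j Const_Atom) (enc_nat j) r (2 * j + 1)"
  using evals_add_const[OF evals_Const_Atom, of 0] by (simp add: add.commute)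

definition easy :: "nat \<Rightarrow> bool" where
  "easy s \<longleftrightarrow> s = 1 \<or> digit \<epsilon> 1 \<and> digit \<epsilon> 2 \<and> digit \<epsilon> 3"

text \<open>The time is constant: this test comes before anything that depends on the size of
  \<open>s\<close> or on further digits.\<close>

lemma evals_easy:
  assumes "1 \<le> s"
  shows "evals [Pair (enc_nat n) (enc_nat s)] r f_easy (enc_bool (easy s)) r 50"
proof -
  obtain s' where s: "s = Suc s'" using assms by (cases s) auto
  consider "s' = 0" | "s' \<noteq> 0" "\<not> digit \<epsilon> 1" | "s' \<noteq> 0" "digit \<epsilon> 1" "\<not> digit \<epsilon> 2"
    | "s' \<noteq> 0" "digit \<epsilon> 1" "digit \<epsilon> 2" by blast
  then show ?thesis
  proof cases
    case 1
    then show ?thesis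
      by - (rule evals_weaken, unfold f_easy_def,
        (rule evals_const evals_Digit evals_rules | simp add: s easy_def One_nat_def[symmetric])+)
  next
    case 2
    then show ?thesis
      by - (rule evals_weaken, unfold f_easy_def,
        (rule evals_const evals_Digit evals_rules | simp add: s easy_def One_nat_def[symmetric])+)
  next
    case 3
    then show ?thesis
      by - (rule evals_weaken, unfold f_easy_def,
        (rule evals_const evals_Digit evals_rules | simp add: s easy_def One_nat_def[symmetric])+)
  next
    case 4
    then show ?thesis
      by - (rule evals_weaken, unfold f_easy_def,
        (rule evals_const evals_Digit evals_rules | simp add: s easy_def One_nat_def[symmetric])+)
  qed
qed

definition majority :: "bool list list \<Rightarrow> int" where
  "majority xs = (if length (filter (\<lambda>x. f x = 1) xs) > length (filter (\<lambda>x. f x \<noteq> 1) xs) then 1 else -1)"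

definition label :: "bool list list \<Rightarrow> sample" where
  "label xs = map (\<lambda>x. (x, f x = 1)) xs"

definition relevant_vars :: "bool list list \<Rightarrow> nat list" where
  "relevant_vars xs = elim_vars f (label xs) n [] []"

text \<open>The bound must be free of \<open>s\<close>, because the permitted time can be polynomial
  in \<open>n\<close> alone.\<close>

lemma calls_main_easy:
  assumes "1 \<le> s" "easy s" "\<forall>x\<in>set xs. length x = n" "length xs = 2 ^ (c + 2 + bit_length n)"
  shows "calls 0 (Pair (enc_nat n) (enc_nat s)) (concat xs @ r) (enc_dtree (Leaf (majority xs))) r
    (100 * n + (50 * n + 300) * (length xs + 1) + 2 * c + 300)"
proof -
  note sample = calls_sample[OF assms(3), folded label_def]
  have pow: "calls 3 (enc_nat (Suc (Suc c) + bit_length n)) r (enc_nat (length xs)) r (100 * length xs)" for r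
    using calls_pow2[of "c + 2 + bit_length n" r] assms(4) by simp
  have maj: "calls 18 (Pair (enc_sample (label xs)) (Pair Atom Atom)) r
    (enc_sign (majority xs)) r (50 * length xs + 50)"
  proof -
    have "enc_sign (majority xs) = enc_bool (length (filter snd (label xs)) >
        length (filter (Not \<circ> snd) (label xs)))"
      by (simp add: label_def majority_def filter_map comp_def enc_sign_def)
    then show ?thesis using calls_majority[of "label xs" 0 0 r] by (simp add: label_def)
  qed
  show ?thesis using assms(1,2)
    by - (rule callsI, rule prog_nth, simp, unfold f_main_def,
      (rule evals_easy evals_add_const evals_rules calls_bit_length pow sample maj | simp | simp add: algebra_simps)+)
qed

text \<open>The exponent is bracketed in the order in which the program adds it up, and
  \<open>k\<close> is the position of the leading digit of \<epsilon>.\<close>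

lemma calls_main_hard:
  assumes "1 \<le> s" "\<not> easy s" "\<forall>x\<in>set xs. length x = n"
    and M: "length xs = 2 ^ (c + 2 + (k + (bit_length n + bit_length s * bit_length s)))"
    and k: "1 \<le> k" "digit \<epsilon> k" "\<And>i. 1 \<le> i \<Longrightarrow> i < k \<Longrightarrow> \<not> digit \<epsilon> i"
    and V: "length (relevant_vars xs) \<le> s" "set (relevant_vars xs) \<subseteq> {..<n}"
  shows "calls 0 (Pair (enc_nat n) (enc_nat s)) (concat xs @ r)
    (enc_opt (search (bit_length s) (relevant_vars xs) (label xs))) r
    (search_time s (length xs) (bit_length s) (length (relevant_vars xs))
      + (400 * n + 600) * (n + 1) * (length xs + 1) + 100 * s + 100 * (bit_length s + 1)\<^sup>2 + (k + 30)\<^sup>2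
      + 20 * bit_length n + 2 * c)"
proof -
  note sample = calls_sample[OF assms(3), folded label_def]
  have pow: "calls 3 (enc_nat (Suc (Suc c) + (k + (bit_length n + bit_length s * bit_length s)))) r (enc_nat (length xs)) r
      (100 * length xs)" for r
    using calls_pow2[of "c + 2 + (k + (bit_length n + bit_length s * bit_length s))" r] M by simp
  have fits_size: "fits_size (length xs) (label xs)" using assms(3) by (auto simp: fits_size_def label_def)
  have elim: "calls 12 (Pair (enc_sample (label xs)) (Pair (enc_nat n) (Pair Atom Atom))) r
    (vlist (map enc_nat (relevant_vars xs))) r
    ((100 * n + 200) * (length xs + 1) * (n + 1))" for r
    using calls_elim[of "label xs" n "[]" "[]"] assms(3) by (auto simp: label_def relevant_vars_def)
  \<comment> \<open>The scan starts at position 1, right behind the point, so it advances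
    \<open>k - 1\<close> times.\<close>
  have dig: "calls 6 (Pair Atom Atom) r (enc_nat k) r (k * (k + 20))" for r
    using calls_first_digit[of 1 "k - 1" r] k by (simp add: Suc_diff_Suc)
  note srch = calls_search[OF V fits_size]
  show ?thesis using assms(1,2)
    by - (rule callsI, rule prog_nth, simp, unfold f_main_def,
      (rule evals_easy evals_const evals_add_const evals_rules calls_bit_length calls_add calls_mul pow sample dig elim srch
        | simp | simp add: algebra_simps power2_eq_square)+)
qed

end
declare One_nat_def [simp]


section \<open>Variables of decision trees\<close>

primrec tree_vars :: "dtree \<Rightarrow> nat set" where
  "tree_vars (Leaf y) = {}"
| "tree_vars (Node i l r) = insert i (tree_vars l \<union> tree_vars r)"

lemma finite_tree_vars [simp]: "finite (tree_vars t)"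
  by (induction t) auto

lemma leaves_ge_1: "1 \<le> leaves t"
  by (induction t) auto

text \<open>A binary tree has one inner node fewer than leaves.\<close>

lemma card_tree_vars_less: "card (tree_vars t) < leaves t"
proof (induction t)
  case (Node i l r)
  have "card (tree_vars (Node i l r)) \<le> Suc (card (tree_vars l \<union> tree_vars r))"
    by (simp add: card_insert_if)
  also have "card (tree_vars l \<union> tree_vars r) \<le> card (tree_vars l) + card (tree_vars r)"
    by (rule card_Un_le)
  finally show ?case using Node by simp
qed simp

lemma dt_eval_cong: "(\<And>i. i \<in> tree_vars t \<Longrightarrow> x ! i = y ! i) \<Longrightarrow> dt_eval t x = dt_eval t y"
  by (induction t) auto

lemma dt_eval_sign: "dt_wf n t \<Longrightarrow> dt_eval t x \<in> {-1, 1}"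
  by (induction t) auto

lemma tree_vars_less: "dt_wf n t \<Longrightarrow> tree_vars t \<subseteq> {..<n}"
  by (induction t) auto

text \<open>The restriction of a tree to the subcube where coordinate \<open>i\<close> is
  \<open>b\<close>.\<close>

primrec fix_var :: "nat \<Rightarrow> bool \<Rightarrow> dtree \<Rightarrow> dtree" where
  "fix_var i b (Leaf y) = Leaf y"
| "fix_var i b (Node j l r) =
     (if j = i then (if b then fix_var i b r else fix_var i b l)
      else Node j (fix_var i b l) (fix_var i b r))"

lemma fix_var:
  "leaves (fix_var i b t) \<le> leaves t" "tree_vars (fix_var i b t) \<subseteq> tree_vars t - {i}"
  "x ! i = b \<Longrightarrow> dt_eval (fix_var i b t) x = dt_eval t x"
  by (induction t) auto

text \<open>The restriction that sets all coordinates outside the mask to 0: their tests always take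
  the left branch.\<close>

primrec mask_tree :: "bool list \<Rightarrow> dtree \<Rightarrow> dtree" where
  "mask_tree m (Leaf y) = Leaf y"
| "mask_tree m (Node j l r) =
     (if m ! j then Node j (mask_tree m l) (mask_tree m r) else mask_tree m l)"

lemma mask_tree:
  "leaves (mask_tree m t) \<le> leaves t" "dt_wf n t \<Longrightarrow> tree_vars (mask_tree m t) \<subseteq> {i. i < n \<and> m ! i}"
  "dt_wf n t \<Longrightarrow> length x = n \<Longrightarrow> length m = n \<Longrightarrow> dt_eval (mask_tree m t) x = dt_eval t (band x m)"
  by (induction t) (auto simp: band_def)


section \<open>The search finds a small consistent tree\<close>

definition consistent :: "dtree \<Rightarrow> sample \<Rightarrow> bool" where
  "consistent t S \<longleftrightarrow> (\<forall>(x, y)\<in>set S. (dt_eval t x = 1) = y)"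

lemma consistent_NodeI:
  "consistent l (split_sample i False S) \<Longrightarrow> consistent r (split_sample i True S) \<Longrightarrow>
   consistent (Node i l r) S"
  unfolding consistent_def split_sample_def by force

lemma consistent_fix_var: "consistent t S \<Longrightarrow> consistent (fix_var i b t) (split_sample i b S)"
  by (auto simp: consistent_def split_sample_def fix_var(3))

lemma consistent_Node_split:
  "consistent (Node i l r) S \<Longrightarrow> consistent (if b then r else l) (split_sample i b S)"
  unfolding consistent_def split_sample_def by force

text \<open>One subtree comes from budget \<open>r\<close>, the other from at most
  \<open>Suc r\<close>, both over one variable less; the claimed leaf count is built to absorb this
  sum.\<close>

lemma search_split_sound:
  assumes "search_split (Suc r) S D W = Some t" "set D \<union> set W \<subseteq> {..<n}"
    and "v = length D + length W"
    and IH: "\<And>r V S t. length V < v \<Longrightarrow> search r V S = Some t \<Longrightarrow> set V \<subseteq> {..<n} \<Longrightarrow>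
      consistent t S \<and> dt_wf n t \<and> leaves t \<le> (length V + 1) ^ r"
  shows "consistent t S \<and> dt_wf n t \<and> leaves t \<le> (v + 1) ^ Suc r"
  using assms(1-3)
proof (induction W arbitrary: D)
  case Nil
  then show ?case by (simp add: search_split.simps)
next
  case (Cons i W)
  let ?R = "D @ W"
  let ?S0 = "split_sample i False S" and ?S1 = "split_sample i True S"
  have R: "length ?R < v" "length ?R + 1 = v" "set ?R \<subseteq> {..<n}" and i: "i < n" using Cons.prems by auto
  note eq = Cons.prems(1)[unfolded search_split.simps Let_def diff_Suc_1]
  note IHR = IH[OF R(1) _ R(3), unfolded R(2)]
  show ?case
  proof (cases "search r ?R ?S0 = None \<and> search r ?R ?S1 = None")
    case True
    then show ?thesis using Cons.IH[of "i # D"] Cons.prems eq by simp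
  next
    case False
    then obtain ta tb where t: "t = Node i ta tb"
      and a: "(if search r ?R ?S0 = None then search (Suc r) ?R ?S0 else search r ?R ?S0) = Some ta"
      and b: "(if search r ?R ?S1 = None then search (Suc r) ?R ?S1 else search r ?R ?S1) = Some tb"
      using eq by (auto split: option.splits if_splits)
    have v: "1 \<le> v" using R by linarith
    define p q where "p = v ^ r" and "q = v ^ Suc r"
    have pow: "p \<le> q" unfolding p_def q_def using v by simp
    \<comment> \<open>The left-hand side is \<open>v ^ r * (v + 1)\<close>.\<close>
    have sum: "p + q \<le> (v + 1) ^ Suc r"
      unfolding p_def q_def using power_mono[of v "v + 1" r] mult_left_mono[of "v ^ r" "(v + 1) ^ r" "v + 1"]
      by (simp add: algebra_simps)
    have la: "consistent ta ?S0 \<and> dt_wf n ta \<and> leaves ta \<le> (if search r ?R ?S0 = None then q else p)"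
    proof (cases "search r ?R ?S0")
      case None
      then show ?thesis using a IHR[of "Suc r" ?S0 ta] by (simp add: q_def)
    next
      case (Some y)
      then show ?thesis using a IHR[of r ?S0 ta] by (simp add: p_def)
    qed
    have lb: "consistent tb ?S1 \<and> dt_wf n tb \<and> leaves tb \<le> (if search r ?R ?S1 = None then q else p)"
    proof (cases "search r ?R ?S1")
      case None
      then show ?thesis using b IHR[of "Suc r" ?S1 tb] by (simp add: q_def)
    next
      case (Some y)
      then show ?thesis using b IHR[of r ?S1 tb] by (simp add: p_def)
    qed
    have "leaves ta + leaves tb \<le> p + q"
      using False la lb pow by (cases "search r ?R ?S0"; cases "search r ?R ?S1") auto
    then show ?thesis unfolding t using la lb sum i by (simp add: consistent_NodeI)
  qed
qed

lemma search_sound: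
  "search r V S = Some t \<Longrightarrow> set V \<subseteq> {..<n} \<Longrightarrow>
   consistent t S \<and> dt_wf n t \<and> leaves t \<le> (length V + 1) ^ r"
proof (induction "length V" arbitrary: r V S t rule: less_induct)
  case less
  show ?case
  proof (cases "all_labels True S \<or> all_labels False S")
    case True
    then show ?thesis using less.prems
      by (auto simp: search.simps consistent_def all_labels_def split: if_splits)
  next
    case False
    then obtain r' where r: "r = Suc r'" "search_split (Suc r') S [] V = Some t"
      using less.prems(1) by (cases r) (auto simp: search.simps)
    show ?thesis unfolding r(1)
      by (rule search_split_sound[OF r(2)]) (use less in auto)
  qed
qed

text \<open>By \<open>one\<close>, the scan stops at \<open>i\<close> at the latest. Wherever it
  stops, \<open>all\<close> makes the repetition with full budget succeed, so stopping at another
  variable does no harm. The lists \<open>V\<close> need only cover the remaining variables, because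
  the scan reorders them.\<close>

lemma search_split_complete:
  assumes "i \<in> set W"
    and all: "\<And>j V b. j \<in> set D \<union> set W \<Longrightarrow> length V < length D + length W \<Longrightarrow>
      (set D \<union> set W) - {j} \<subseteq> set V \<Longrightarrow> search (Suc r) V (split_sample j b S) \<noteq> None"
    and one: "\<And>V. length V < length D + length W \<Longrightarrow> (set D \<union> set W) - {i} \<subseteq> set V \<Longrightarrow>
      search r V (split_sample i False S) \<noteq> None \<or> search r V (split_sample i True S) \<noteq> None"
  shows "search_split (Suc r) S D W \<noteq> None"
  using assms
proof (induction W arbitrary: D)
  case (Cons j W)
  let ?a = "search r (D @ W) (split_sample j False S)" and ?b = "search r (D @ W) (split_sample j True S)"
  have full: "search (Suc r) (D @ W) (split_sample j b S) \<noteq> None" for b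
    by (rule Cons.prems(2)) auto
  show ?case
  proof (cases "?a = None \<and> ?b = None")
    case True
    have "j \<noteq> i"
      using Cons.prems(3)[of "D @ W"] True by auto
    then have "search_split (Suc r) S (j # D) W \<noteq> None"
      using Cons.prems by (intro Cons.IH) (auto simp: insert_commute)
    then show ?thesis using True by (simp add: search_split.simps)
  next
    case False
    then show ?thesis using full[of False] full[of True] by (auto simp: search_split.simps Let_def)
  qed
qed simp

text \<open>Committing to a wrong root loses nothing: restricting \<open>t\<close> to either half of
  the sample does not add leaves and removes the variable. The true root passes the cheap test,
  because one of its subtrees has at most half of the permitted leaves.\<close>

lemma search_complete:
  "consistent t S \<Longrightarrow> leaves t \<le> 2 ^ r \<Longrightarrow> tree_vars t \<subseteq> set V \<Longrightarrow> search r V S \<noteq> None"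
proof (induction "length V" arbitrary: r V S t rule: less_induct)
  case less
  show ?case
  proof (cases "all_labels True S \<or> all_labels False S")
    case True
    then show ?thesis by (auto simp: search.simps)
  next
    case False
    have "t \<noteq> Leaf z" for z
      using less.prems(1) False by (cases "z = 1") (auto simp: consistent_def all_labels_def)
    then obtain i tl tr where t: "t = Node i tl tr" by (cases t) auto
    have "leaves tl + leaves tr \<le> 2 ^ r" using less.prems(2) t by simp
    then obtain r' where r: "r = Suc r'" using leaves_ge_1[of tl] leaves_ge_1[of tr] by (cases r) auto
    have "search_split (Suc r') S [] V \<noteq> None"
    proof (rule search_split_complete)
      show "i \<in> set V" using less.prems t by simp
    next
      fix j U b
      assume "j \<in> set [] \<union> set V" "length U < length [] + length V" "(set [] \<union> set V) - {j} \<subseteq> set U"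
      then show "search (Suc r') U (split_sample j b S) \<noteq> None"
        using less.prems fix_var(1,2)[of j b t] r consistent_fix_var[OF less.prems(1), of j b]
        by (intro less.hyps[of U "fix_var j b t"]) auto
    next
      fix U :: "nat list"
      assume U: "length U < length [] + length V" "(set [] \<union> set V) - {i} \<subseteq> set U"
      \<comment> \<open>\<open>u\<close> is the subtree with fewer leaves, and \<open>b\<close> is
        the side it is on.\<close>
      define b where "b \<longleftrightarrow> leaves tr \<le> leaves tl"
      define u where "u = (if b then tr else tl)"
      have u: "leaves u \<le> 2 ^ r'" "tree_vars u \<subseteq> set V" "consistent u (split_sample i b S)"
        using less.prems consistent_Node_split[of i tl tr S b]
        unfolding u_def b_def t r by auto
      \<comment> \<open>\<open>u\<close> may test \<open>i\<close> again although \<open>U\<close>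
        need not contain it, so \<open>i\<close> is fixed once more; splitting the sample twice has
        no further effect.\<close>
      have "search r' U (split_sample i b (split_sample i b S)) \<noteq> None"
        using U u fix_var(1,2)[of i b u] by (intro less.hyps[of U "fix_var i b u"] consistent_fix_var) auto
      moreover have "split_sample i b (split_sample i b S) = split_sample i b S"
        by (simp add: split_sample_def)
      ultimately show "search r' U (split_sample i False S) \<noteq> None \<or> search r' U (split_sample i True S) \<noteq> None"
        by (cases b) auto
    qed
    then show ?thesis using False r by (auto simp: search.simps)
  qed
qed

section \<open>Elimination keeps only relevant variables\<close>

text \<open>If \<open>t\<close> does not test coordinate \<open>k\<close>, switching it off changes
  no relevant value of \<open>f\<close>, and the agreement test passes. Hence a kept coordinate is
  tested by \<open>t\<close>. The invariant ties \<open>V\<close> to the ones of the mask from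
  \<open>k\<close> on.\<close>

lemma elim_vars_invariant:
  assumes "\<And>x. length x = n \<Longrightarrow> f x = dt_eval t x"
    and "\<forall>(x, y)\<in>set S. length x = n" "tree_vars t \<subseteq> {..<n}"
  shows "length m + k = n \<Longrightarrow> agrees f S (replicate k True @ m) \<Longrightarrow>
    set V = {i. k \<le> i \<and> i < n \<and> m ! (i - k)} \<Longrightarrow> distinct V \<Longrightarrow> set V \<subseteq> tree_vars t \<Longrightarrow>
    \<exists>m'. length m' = n \<and> agrees f S m' \<and> set (elim_vars f S k m V) = {i. i < n \<and> m' ! i} \<and>
      distinct (elim_vars f S k m V) \<and> set (elim_vars f S k m V) \<subseteq> tree_vars t"
proof (induction k arbitrary: m V)
  case 0
  then show ?case by auto
next
  case (Suc k)
  \<comment> \<open>Prepending \<open>b\<close> shifts the mask by one place: coordinate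
    \<open>k\<close> receives \<open>b\<close>, and the others keep their bits.\<close>
  have nth: "k \<le> i \<and> i < n \<and> (b # m) ! (i - k) \<longleftrightarrow> i = k \<and> b \<or> i \<in> set V" for i b
  proof (cases "Suc k \<le> i")
    case True
    then have "i - k = Suc (i - Suc k)" by simp
    then have "(b # m) ! (i - k) = m ! (i - Suc k)" by simp
    then show ?thesis using True unfolding Suc.prems(3) by simp
  next
    case False
    then show ?thesis using Suc.prems(1) unfolding Suc.prems(3) by (cases "i = k") simp_all
  qed
  show ?case
  proof (cases "agrees f S (replicate k True @ False # m)")
    case True
    have "elim_vars f S (Suc k) m V = elim_vars f S k (False # m) V" using True by simp
    then show ?thesis
    proof (elim ssubst, intro Suc.IH)
      show "set V = {i. k \<le> i \<and> i < n \<and> (False # m) ! (i - k)}" unfolding nth by simp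
    qed (use Suc.prems(1,4,5) True in simp_all)
  next
    case False
    have V: "set (k # V) = {i. k \<le> i \<and> i < n \<and> (True # m) ! (i - k)}"
      unfolding nth by auto
    have "k \<in> tree_vars t"
    proof (rule ccontr)
      assume k: "k \<notin> tree_vars t"
      have "agrees f S (replicate k True @ False # m)"
        unfolding agrees_def
      proof (intro ballI, clarify)
        fix x y assume xy: "(x, y) \<in> set S"
        then have x: "length x = n" using assms(2) by auto
        have "dt_eval t (band x (replicate k True @ False # m)) = dt_eval t (band x (replicate (Suc k) True @ m))"
        proof (rule dt_eval_cong)
          fix i assume "i \<in> tree_vars t"
          then have "i \<noteq> k" "i < n" using k assms(3) by auto
          then show "band x (replicate k True @ False # m) ! i = band x (replicate (Suc k) True @ m) ! i"
            using x Suc.prems(1)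
            by (auto simp: band_def nth_append nth_Cons' replicate_app_Cons_same[symmetric] simp del: replicate_Suc)
        qed
        then have "f (band x (replicate k True @ False # m)) = f (band x (replicate (Suc k) True @ m))"
          using x Suc.prems(1) by (simp add: assms(1) band_def)
        then show "(f (band x (replicate k True @ False # m)) = 1) = y"
          using Suc.prems(2) xy unfolding agrees_def by auto
      qed
      with False show False by simp
    qed
    moreover have "k \<notin> set V" unfolding Suc.prems(3) by simp
    moreover have "agrees f S (replicate k True @ True # m)"
      using Suc.prems(2) by (simp add: replicate_app_Cons_same)
    moreover have "elim_vars f S (Suc k) m V = elim_vars f S k (True # m) (k # V)" using False by simp
    ultimately show ?thesis
      using Suc.prems(1,4,5) by (elim ssubst, intro Suc.IH V) simp_all
  qed
qed

section \<open>Counting\<close>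

definition samples :: "nat \<Rightarrow> nat \<Rightarrow> bool list list set" where
  "samples n m = {xs. set xs \<subseteq> cube n \<and> length xs = m}"

lemma cube_conv_lists: "cube n = {x. set x \<subseteq> UNIV \<and> length x = n}"
  by (simp add: cube_def)

lemma finite_cube [simp]: "finite (cube n)"
  unfolding cube_conv_lists by (rule finite_lists_length_eq) simp

lemma card_cube: "card (cube n) = 2 ^ n"
  unfolding cube_conv_lists by (subst card_lists_length_eq) auto

lemma cube_nonempty: "cube n \<noteq> {}"
  using card_cube[of n] by force

lemma finite_samples [simp]: "finite (samples n m)"
  unfolding samples_def by (rule finite_lists_length_eq) simp

lemma card_samples: "card (samples n m) = (2 ^ n) ^ m"
  unfolding samples_def by (subst card_lists_length_eq) (auto simp: card_cube)

text \<open>Expanding the power by distributivity gives one product per list. In probabilistic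
  terms, the expectation of a product over independent points factorises.\<close>

lemma sum_prod_list_lists:
  fixes g :: "'a \<Rightarrow> real"
  assumes "finite A"
  shows "(\<Sum>xs | set xs \<subseteq> A \<and> length xs = m. prod_list (map g xs)) = (\<Sum>x\<in>A. g x) ^ m"
proof (induction m)
  case 0
  have "{xs. set xs \<subseteq> A \<and> length xs = 0} = {[]}" by auto
  then show ?case by simp
next
  case (Suc m)
  let ?L = "\<lambda>m. {xs. set xs \<subseteq> A \<and> length xs = m}"
  have "?L (Suc m) = (\<lambda>(x, xs). x # xs) ` (A \<times> ?L m)"
    by (auto simp: length_Suc_conv image_iff)
  moreover have inj: "inj_on (\<lambda>(x, xs). x # xs) (A \<times> ?L m)" by (auto simp: inj_on_def)
  ultimately have "(\<Sum>xs\<in>?L (Suc m). prod_list (map g xs)) = (\<Sum>(x, xs)\<in>A \<times> ?L m. g x * prod_list (map g xs))"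
    by (simp only: sum.reindex[OF inj]) (simp add: comp_def case_prod_beta)
  also have "\<dots> = (\<Sum>x\<in>A. g x) * (\<Sum>xs\<in>?L m. prod_list (map g xs))"
    by (simp add: sum_product sum.cartesian_product)
  finally show ?case using Suc.IH by simp
qed

lemma dt_error_conv: "dt_error n h f = card {x \<in> cube n. dt_eval h x \<noteq> f x} / 2 ^ n"
proof -
  have "cube n \<inter> {x. dt_eval h x \<noteq> f x} = {x \<in> cube n. dt_eval h x \<noteq> f x}" by auto
  then show ?thesis unfolding dt_error_def
    by (subst measure_pmf_of_set) (use cube_nonempty in \<open>auto simp: card_cube\<close>)
qed

lemma card_agreement: "card {x \<in> cube n. dt_eval h x = f x} = 2 ^ n * (1 - dt_error n h f)"
proof -
  have "cube n = {x \<in> cube n. dt_eval h x = f x} \<union> {x \<in> cube n. dt_eval h x \<noteq> f x}" by auto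
  then have "card (cube n) = card {x \<in> cube n. dt_eval h x = f x} + card {x \<in> cube n. dt_eval h x \<noteq> f x}"
    by (subst card_Un_disjoint[symmetric]) auto
  then have "real (2 ^ n) = real (card {x \<in> cube n. dt_eval h x = f x}) + real (card {x \<in> cube n. dt_eval h x \<noteq> f x})"
    by (simp add: card_cube flip: of_nat_add)
  moreover have "2 ^ n * (1 - dt_error n h f) = 2 ^ n - real (card {x \<in> cube n. dt_eval h x \<noteq> f x})"
    by (simp add: dt_error_conv right_diff_distrib)
  ultimately show ?thesis by simp
qed

section \<open>The number of small trees\<close>

primrec tree_word :: "dtree \<Rightarrow> nat list" where
  "tree_word (Leaf y) = [if y = 1 then 1 else 0]"
| "tree_word (Node i l r) = (i + 2) # tree_word l @ tree_word r"

text \<open>In the preorder word, letters 0 and 1 mark leaves and larger ones variables, so a word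
  shows where its tree ends. The tails \<open>xs\<close> and \<open>ys\<close> carry the induction
  into subtrees and later absorb padding.\<close>

lemma tree_word_prefix_free:
  "dt_wf n t \<Longrightarrow> dt_wf n u \<Longrightarrow> tree_word t @ xs = tree_word u @ ys \<Longrightarrow> t = u \<and> xs = ys"
proof (induction t arbitrary: u xs ys)
  case (Leaf y)
  then show ?case by (cases u) (auto split: if_splits)
next
  case (Node i l r)
  obtain j l' r' where u: "u = Node j l' r'"
    using Node.prems(3) by (cases u) (auto split: if_splits)
  have eq: "tree_word l @ (tree_word r @ xs) = tree_word l' @ (tree_word r' @ ys)" and "i = j"
    using Node.prems(3) u by auto
  from Node.IH(1)[OF _ _ eq] have "l = l'" "tree_word r @ xs = tree_word r' @ ys"
    using Node.prems u by auto
  with Node.IH(2)[of r' xs ys] Node.prems u \<open>i = j\<close> show ?case by simp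
qed

lemma length_tree_word: "length (tree_word t) < 2 * leaves t"
  by (induction t) auto

lemma set_tree_word: "dt_wf n t \<Longrightarrow> set (tree_word t) \<subseteq> {..<n + 2}"
  by (induction t) auto

text \<open>A tree with \<open>K\<close> leaves has \<open>2 * K - 1\<close> nodes, so its word can
  be padded to length \<open>2 * K\<close> over \<open>n + 2\<close> letters; by prefix-freeness the
  padded words stay distinct.\<close>

lemma trees_bound:
  "finite {h. dt_wf n h \<and> leaves h \<le> K}" "card {h. dt_wf n h \<and> leaves h \<le> K} \<le> (n + 2) ^ (2 * K)"
proof -
  let ?H = "{h. dt_wf n h \<and> leaves h \<le> K}"
  let ?L = "{xs. set xs \<subseteq> {..<n + 2} \<and> length xs = 2 * K}"
  define g where "g h = tree_word h @ replicate (2 * K - length (tree_word h)) 0" for h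
  have inj: "inj_on g ?H"
    unfolding inj_on_def g_def using tree_word_prefix_free by blast
  have sub: "g ` ?H \<subseteq> ?L"
  proof
    fix xs assume "xs \<in> g ` ?H"
    then obtain h where h: "dt_wf n h" "leaves h \<le> K" "xs = g h" by auto
    then show "xs \<in> ?L"
      using length_tree_word[of h] set_tree_word[OF h(1)] by (auto simp: g_def)
  qed
  have fin: "finite ?L" by (rule finite_lists_length_eq) simp
  show "finite ?H" using finite_subset[OF sub fin] inj by (rule finite_imageD)
  show "card ?H \<le> (n + 2) ^ (2 * K)"
    using card_inj_on_le[OF inj sub fin] by (simp add: card_lists_length_eq)
qed

text \<open>Union bound: a fixed tree with error above \<epsilon> agrees with \<open>m\<close>
  independent points with probability at most \<open>(1 - \<epsilon>) ^ m\<close>, and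
  \<open>trees_bound\<close> limits the number of trees.\<close>

lemma occam:
  assumes "0 < \<epsilon>" "\<epsilon> < 1"
  shows "card {xs \<in> samples n m. \<exists>h. dt_wf n h \<and> leaves h \<le> K \<and> dt_error n h f > \<epsilon> \<and>
      (\<forall>x\<in>set xs. dt_eval h x = f x)}
    \<le> real (n + 2) ^ (2 * K) * (1 - \<epsilon>) ^ m * card (samples n m)"
proof -
  define H where "H = {h. dt_wf n h \<and> leaves h \<le> K \<and> dt_error n h f > \<epsilon>}"
  define G where "G h = {x \<in> cube n. dt_eval h x = f x}" for h
  have sub: "H \<subseteq> {h. dt_wf n h \<and> leaves h \<le> K}" by (auto simp: H_def)
  have finH: "finite H" using sub trees_bound(1) by (rule finite_subset)
  have cardH: "card H \<le> (n + 2) ^ (2 * K)"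
    using card_mono[OF trees_bound(1) sub] trees_bound(2) by (rule order_trans)
  have one: "real (card {xs. set xs \<subseteq> G h \<and> length xs = m}) \<le> (1 - \<epsilon>) ^ m * card (samples n m)"
    if "h \<in> H" for h
  proof -
    have "real (card (G h)) \<le> 2 ^ n * (1 - \<epsilon>)"
      using that unfolding G_def card_agreement H_def by simp
    then have "real (card (G h)) ^ m \<le> (2 ^ n * (1 - \<epsilon>)) ^ m"
      by (rule power_mono) simp
    then show ?thesis
      by (subst card_lists_length_eq) (auto simp: G_def card_samples power_mult_distrib mult.commute)
  qed
  have "{xs \<in> samples n m. \<exists>h. dt_wf n h \<and> leaves h \<le> K \<and> dt_error n h f > \<epsilon> \<and>
      (\<forall>x\<in>set xs. dt_eval h x = f x)} \<subseteq> (\<Union>h\<in>H. {xs. set xs \<subseteq> G h \<and> length xs = m})"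
    (is "?bad \<subseteq> ?U") by (auto simp: samples_def H_def G_def)
  moreover have "finite ?U"
    using finH by (auto intro!: finite_lists_length_eq simp: G_def)
  ultimately have "card ?bad \<le> card ?U" by (rule card_mono[rotated])
  also have "\<dots> \<le> (\<Sum>h\<in>H. card {xs. set xs \<subseteq> G h \<and> length xs = m})"
    by (rule card_UN_le[OF finH])
  finally have "real (card ?bad) \<le> (\<Sum>h\<in>H. real (card {xs. set xs \<subseteq> G h \<and> length xs = m}))"
    by (simp flip: of_nat_sum)
  also have "\<dots> \<le> (\<Sum>h\<in>H. (1 - \<epsilon>) ^ m * card (samples n m))"
    by (rule sum_mono) (rule one)
  also have "\<dots> = real (card H) * ((1 - \<epsilon>) ^ m * card (samples n m))" by simp
  also have "\<dots> \<le> real ((n + 2) ^ (2 * K)) * ((1 - \<epsilon>) ^ m * card (samples n m))"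
    using cardH assms by (intro mult_right_mono) (simp_all del: of_nat_power)
  finally show ?thesis by (simp add: mult.assoc)
qed

section \<open>Tail bound for frequencies in a sample\<close>

lemma prod_list_if: "prod_list (map (\<lambda>x. if P x then a else 1) xs) = (a::real) ^ length (filter P xs)"
  by (induction xs) auto

text \<open>Chernoff's method with base 4.\<close>
lemma card_frequent:
  assumes "card {x \<in> cube n. P x} \<le> 2 ^ n / (8::real)"
  shows "card {xs \<in> samples n m. m \<le> 2 * length (filter P xs)} \<le> (11 / 16) ^ m * card (samples n m)"
    (is "real (card ?bad) \<le> _")
proof -
  let ?g = "\<lambda>x. if P x then 4 else (1::real)"
  have "2 ^ m * real (card ?bad) = (\<Sum>xs\<in>?bad. 2 ^ m)" by simp
  also have "\<dots> \<le> (\<Sum>xs\<in>?bad. prod_list (map ?g xs))"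
  proof (rule sum_mono)
    fix xs assume "xs \<in> ?bad"
    then have "(2::real) ^ m \<le> 2 ^ (2 * length (filter P xs))" by (intro power_increasing) auto
    then show "2 ^ m \<le> prod_list (map ?g xs)" by (simp add: prod_list_if power_mult)
  qed
  also have "\<dots> \<le> (\<Sum>xs\<in>samples n m. prod_list (map ?g xs))"
    by (rule sum_mono2) (auto simp: prod_list_if)
  also have "\<dots> = (\<Sum>x\<in>cube n. ?g x) ^ m"
    unfolding samples_def by (rule sum_prod_list_lists) simp
  also have "(\<Sum>x\<in>cube n. ?g x) = (\<Sum>x\<in>cube n. 1 + (if P x then 3 else 0))"
    by (rule sum.cong) auto
  also have "\<dots> = 2 ^ n + 3 * real (card {x \<in> cube n. P x})"
    by (simp add: sum.distrib card_cube sum.If_cases Int_def)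
  \<comment> \<open>The mean weight of a point is at most 1 + 3/8 = 11/8; the factor 2 per point on
    the left then gives 11/16.\<close>
  also have "\<dots> ^ m \<le> (2 ^ n * (11 / 8)) ^ m"
    using assms by (intro power_mono) auto
  also have "(2 ^ n * (11 / 8 :: real)) ^ m = 2 ^ m * ((11 / 16) ^ m * real (card (samples n m)))"
  proof -
    have "(2 ^ n * (11 / 8 :: real)) ^ m = (2 * (11 / 16) * 2 ^ n) ^ m" by (simp add: mult.commute)
    then show ?thesis unfolding power_mult_distrib by (simp add: card_samples)
  qed
  finally show ?thesis by simp
qed

section \<open>Coin tapes as samples\<close>

lemma split_tape: "m * n \<le> length r \<Longrightarrow> \<exists>xs\<in>samples n m. \<exists>r'. r = concat xs @ r'"
proof (induction m arbitrary: r)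
  case 0
  then show ?case by (auto simp: samples_def)
next
  case (Suc m)
  then have "m * n \<le> length (drop n r)" by simp
  from Suc.IH[OF this] obtain xs r' where xs: "xs \<in> samples n m" "drop n r = concat xs @ r'" by blast
  have "r = concat (take n r # xs) @ r'" using xs(2) by (metis append.assoc append_take_drop_id concat.simps(2))
  moreover have "take n r # xs \<in> samples n (Suc m)" using xs(1) Suc.prems by (auto simp: samples_def cube_def)
  ultimately show ?case by blast
qed

lemma length_concat_samples: "xs \<in> samples n m \<Longrightarrow> length (concat xs) = m * n"
proof (induction xs arbitrary: m)
  case (Cons x xs)
  then show ?case by (cases m) (auto simp: samples_def cube_def)
qed (simp add: samples_def)

text \<open>The number of points and their length are fixed, so a tape can be cut in only one
  way.\<close>

lemma concat_samples_inj:
  "xs \<in> samples n m \<Longrightarrow> ys \<in> samples n m \<Longrightarrow> concat xs @ r = concat ys @ r' \<Longrightarrow> xs = ys \<and> r = r'"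
proof (induction m arbitrary: xs ys)
  case (Suc m)
  obtain x xs' y ys' where "xs = x # xs'" "ys = y # ys'" "length x = length y"
    "xs' \<in> samples n m" "ys' \<in> samples n m"
    using Suc.prems(1,2) by (auto simp: samples_def length_Suc_conv cube_def)
  then show ?case using Suc.IH[of xs' ys'] Suc.prems(3) by simp
qed (simp add: samples_def)

text \<open>Each good sample extends to \<open>2 ^ (T - m * n)\<close> tapes, and different samples
  give different tapes, so the fraction of good tapes is at least that of good samples.\<close>

lemma tape_prob:
  fixes \<delta> :: real
  assumes "m * n \<le> T" and "card (samples n m - G) \<le> \<delta> * card (samples n m)" "G \<subseteq> samples n m"
    and "\<And>xs r. xs \<in> G \<Longrightarrow> concat xs @ r \<in> P"
  shows "measure_pmf.prob (pmf_of_set {r::bool list. length r = T}) P \<ge> 1 - \<delta>"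
proof -
  let ?A = "{r::bool list. length r = T}"
  let ?L = "cube (T - m * n)"
  have A: "?A = cube T" by (simp add: cube_def)
  have "inj_on (\<lambda>(xs, r). concat xs @ r) (G \<times> ?L)"
    unfolding inj_on_def using concat_samples_inj assms(3) by (auto simp: subset_iff) blast+
  moreover have "(\<lambda>(xs, r). concat xs @ r) ` (G \<times> ?L) \<subseteq> ?A \<inter> P"
    using assms length_concat_samples by (fastforce simp: cube_def)
  ultimately have "card (G \<times> ?L) \<le> card (?A \<inter> P)"
    by (rule card_inj_on_le) (simp add: A)
  then have *: "real (card G) * 2 ^ (T - m * n) \<le> card (?A \<inter> P)"
  proof -
    assume "card (G \<times> ?L) \<le> card (?A \<inter> P)"
    then have "real (card G * 2 ^ (T - m * n)) \<le> real (card (?A \<inter> P))"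
      by (simp only: card_cartesian_product card_cube of_nat_le_iff)
    then show ?thesis by simp
  qed
  have "card (samples n m - G) = card (samples n m) - card G"
    by (rule card_Diff_subset) (use assms(3) finite_subset[OF assms(3) finite_samples] in auto)
  moreover have "card G \<le> card (samples n m)" using assms(3) by (simp add: card_mono)
  ultimately have "real (card G) \<ge> (1 - \<delta>) * card (samples n m)"
    using assms(2) by (simp add: of_nat_diff algebra_simps)
  then have "(1 - \<delta>) * card (samples n m) * 2 ^ (T - m * n) \<le> real (card G) * 2 ^ (T - m * n)"
    by (rule mult_right_mono) simp
  with * have "(1 - \<delta>) * card (samples n m) * 2 ^ (T - m * n) \<le> card (?A \<inter> P)"
    by (rule order_trans[rotated])
  moreover have "real (card (samples n m)) * 2 ^ (T - m * n) = 2 ^ T"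
    using assms(1) by (simp add: card_samples mult.commute flip: power_mult power_add)
  ultimately have "(1 - \<delta>) * 2 ^ T \<le> card (?A \<inter> P)" by (simp add: mult.assoc)
  then have "1 - \<delta> \<le> card (?A \<inter> P) / 2 ^ T" by (simp add: field_simps)
  then show ?thesis
    by (subst measure_pmf_of_set) (use A card_cube[of T] cube_nonempty[of T] in auto)
qed


section \<open>Confidence\<close>

lemma majority_frequent:
  assumes "\<forall>x\<in>cube n. f x \<in> {-1, 1}" "xs \<in> samples n m"
  shows "m \<le> 2 * length (filter (\<lambda>x. f x = majority f xs) xs)"
proof -
  have "length (filter (\<lambda>x. f x = 1) xs) + length (filter (\<lambda>x. f x \<noteq> 1) xs) = m"
    using assms(2) sum_length_filter_compl[of "\<lambda>x. f x = 1" xs] by (simp add: samples_def)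
  moreover have "filter (\<lambda>x. f x \<noteq> 1) xs = filter (\<lambda>x. f x = -1) xs"
    using assms by (intro filter_cong) (auto simp: samples_def)
  ultimately show ?thesis by (auto simp: majority_def)
qed

text \<open>A value whose leaf errs on more than 7/8 of the cube is taken on less than 1/8 of it,
  yet it fills half of the sample; \<open>card_frequent\<close> makes this unlikely. Both values
  cannot be that rare on the cube, so one \<open>b\<close> accounts for all bad samples.\<close>

lemma majority_errs:
  assumes f: "\<forall>x\<in>cube n. f x \<in> {-1, 1}" and \<epsilon>: "7 / 8 \<le> \<epsilon>"
  shows "card {xs \<in> samples n m. dt_error n (Leaf (majority f xs)) f > \<epsilon>}
    \<le> (11 / 16) ^ m * card (samples n m)"
proof (cases "{xs \<in> samples n m. dt_error n (Leaf (majority f xs)) f > \<epsilon>} = {}")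
  case False
  then obtain xs0 where xs0: "xs0 \<in> samples n m" "dt_error n (Leaf (majority f xs0)) f > \<epsilon>" by auto
  define b where "b = majority f xs0"
  have agr: "real (card {x \<in> cube n. f x = b'}) = 2 ^ n * (1 - dt_error n (Leaf b') f)" for b'
    using card_agreement[of n "Leaf b'" f] by (simp add: eq_commute)
  have rare: "real (card {x \<in> cube n. f x = b'}) < 2 ^ n / 8" if "dt_error n (Leaf b') f > \<epsilon>" for b'
  proof -
    have "2 ^ n * (1 - dt_error n (Leaf b') f) < 2 ^ n * (1 / 8)"
      by (rule mult_strict_left_mono) (use that \<epsilon> in simp_all)
    then show ?thesis using agr by simp
  qed
  have "majority f xs = b" if "dt_error n (Leaf (majority f xs)) f > \<epsilon>" for xs
  proof (rule ccontr)
    assume ne: "majority f xs \<noteq> b"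
    have "cube n \<subseteq> {x \<in> cube n. f x = b} \<union> {x \<in> cube n. f x = majority f xs}"
      using f ne by (auto simp: b_def majority_def split: if_splits)
    then have "card (cube n) \<le> card ({x \<in> cube n. f x = b} \<union> {x \<in> cube n. f x = majority f xs})"
      by (rule card_mono[rotated]) simp
    also have "\<dots> \<le> card {x \<in> cube n. f x = b} + card {x \<in> cube n. f x = majority f xs}"
      by (rule card_Un_le)
    finally have "real (2 ^ n) \<le> real (card {x \<in> cube n. f x = b}) + real (card {x \<in> cube n. f x = majority f xs})"
      unfolding card_cube of_nat_add[symmetric] of_nat_le_iff .
    also have "\<dots> < 2 ^ n / 8 + 2 ^ n / 8"
      using rare[OF that] rare[of b] xs0(2) by (simp add: b_def)
    finally show False by simp
  qed
  then have "{xs \<in> samples n m. dt_error n (Leaf (majority f xs)) f > \<epsilon>}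
      \<subseteq> {xs \<in> samples n m. m \<le> 2 * length (filter (\<lambda>x. f x = b) xs)}"
    using majority_frequent[OF f] by fastforce
  then have "card {xs \<in> samples n m. dt_error n (Leaf (majority f xs)) f > \<epsilon>}
      \<le> card {xs \<in> samples n m. m \<le> 2 * length (filter (\<lambda>x. f x = b) xs)}"
    by (rule card_mono[rotated]) simp
  also have "real \<dots> \<le> (11 / 16) ^ m * card (samples n m)"
    by (rule card_frequent) (use rare[of b] xs0(2) in \<open>simp add: b_def\<close>)
  finally show ?thesis by simp
next
  case True
  show ?thesis unfolding True by simp
qed

text \<open>For \<open>s = 1\<close> the vote is unanimous. The sample must be nonempty, since an
  empty one always yields -1.\<close>

lemma majority_const:
  assumes f: "\<forall>x\<in>cube n. f x = b" "b \<in> {-1, 1}" and xs: "xs \<in> samples n m" "m \<noteq> 0"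
  shows "dt_error n (Leaf (majority f xs)) f = 0"
proof -
  have "filter (\<lambda>x. f x = 1) xs = (if b = 1 then xs else [])" "filter (\<lambda>x. f x \<noteq> 1) xs = (if b = 1 then [] else xs)"
    using f xs by (auto simp: samples_def filter_empty_conv subset_iff)
  then have "majority f xs = b" using xs f(2) by (auto simp: majority_def samples_def)
  then have "{x \<in> cube n. dt_eval (Leaf (majority f xs)) x \<noteq> f x} = {}" using f(1) by auto
  then show ?thesis unfolding dt_error_conv by (metis card.empty div_0 of_nat_0)
qed

section \<open>Bit lengths and sufficient sample sizes\<close>

lemma less_power_bit_length: "k < 2 ^ bit_length k"
proof (induction k rule: bit_length.induct)
  case (2 k)
  have "Suc k < 2 * (Suc k div 2 + 1)" by presburger
  also have "\<dots> \<le> 2 * 2 ^ bit_length (Suc k div 2)" using 2 by simp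
  finally show ?case by simp
qed simp

lemma power_bit_length_le: "0 < k \<Longrightarrow> 2 ^ bit_length k \<le> 2 * k"
proof (induction k rule: bit_length.induct)
  case (2 k)
  show ?case
  proof (cases "k = 0")
    case False
    then have "2 ^ bit_length (Suc k div 2) \<le> 2 * (Suc k div 2)" using 2 by simp
    also have "\<dots> \<le> Suc k" by linarith
    finally show ?thesis by simp
  qed simp
qed simp

text \<open>Turns powers of \<open>n + 2\<close>, which count trees and measure confidence, into
  powers of 2 that can be set against the sample size.\<close>

lemma power_less_tower: "real (n + 2) ^ j \<le> 2 ^ (2 ^ bit_length n * j)"
proof -
  have "n + 2 \<le> 2 ^ (n + 1)" by (induction n) auto
  also have "\<dots> \<le> 2 ^ 2 ^ bit_length n" using less_power_bit_length[of n] by (intro power_increasing) auto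
  finally have "real (n + 2) \<le> 2 ^ 2 ^ bit_length n" by (metis of_nat_le_iff of_nat_numeral of_nat_power)
  then have "real (n + 2) ^ j \<le> (2 ^ 2 ^ bit_length n) ^ j" by (rule power_mono) simp
  then show ?thesis by (simp add: power_mult)
qed

lemma majority_confidence: "(11 / 16) ^ 2 ^ (c + 2 + bit_length n) \<le> 1 / (real n + 2) ^ c"
proof -
  \<comment> \<open>One factor 2 of the exponent is spent on squaring, because 121/256 is below
    1/2.\<close>
  have "(11 / 16 :: real) ^ 2 ^ (c + 2 + bit_length n) = ((11 / 16) ^ 2) ^ (2 * (2 ^ bit_length n * 2 ^ c))"
    by (simp add: power_add mult_ac flip: power_mult)
  also have "\<dots> \<le> (1 / 2) ^ (2 * (2 ^ bit_length n * 2 ^ c))"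
    by (rule power_mono) (simp_all add: power2_eq_square)
  also have "\<dots> \<le> (1 / 2) ^ (2 ^ bit_length n * c)"
  proof (rule power_decreasing)
    have "2 ^ bit_length n * c \<le> 2 ^ bit_length n * 2 ^ c" using less_exp[of c] by simp
    then show "2 ^ bit_length n * c \<le> 2 * (2 ^ bit_length n * 2 ^ c)" by (rule order_trans) simp
  qed simp_all
  also have "\<dots> = 1 / 2 ^ (2 ^ bit_length n * c)" by (simp add: power_divide)
  also have "\<dots> \<le> 1 / (real n + 2) ^ c"
    using power_less_tower[of n c] by (intro divide_left_mono) (auto simp: add.commute)
  finally show ?thesis .
qed

text \<open>A block of \<open>2 ^ k\<close> points lowers the bound on agreement to at most 1/e,
  hence below 1/2. The rest of the exponent supplies enough blocks to outweigh both the number of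
  trees and the factor \<open>(n + 2) ^ c\<close>.\<close>

lemma occam_confidence:
  assumes "0 < \<epsilon>" "\<epsilon> < 1" "1 \<le> \<epsilon> * 2 ^ k"
  shows "real (n + 2) ^ (2 * 2 ^ R) * (1 - \<epsilon>) ^ 2 ^ (c + 2 + (k + (bit_length n + R))) \<le> 1 / (real n + 2) ^ c"
proof -
  have exp: "2 \<le> exp (1::real)" using exp_ge_add_one_self[of 1] by simp
  have "(1 - \<epsilon>) ^ 2 ^ k \<le> exp (- \<epsilon>) ^ 2 ^ k"
    using assms exp_ge_add_one_self[of "- \<epsilon>"] by (intro power_mono) auto
  also have "\<dots> = exp (- (\<epsilon> * 2 ^ k))" by (simp flip: exp_of_nat_mult)
  also have "\<dots> \<le> exp (-1)" using assms by simp
  also have "\<dots> \<le> 1 / 2" using exp by (simp add: exp_minus field_simps)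
  finally have half: "(1 - \<epsilon>) ^ 2 ^ k \<le> 1 / 2" .
  \<comment> \<open>\<open>q\<close> is a number of halvings that suffices: by
    \<open>power_less_tower\<close>, \<open>2 ^ q\<close> dominates the tree count times
    \<open>(n + 2) ^ c\<close>.\<close>
  define q where "q = 2 ^ bit_length n * (2 * 2 ^ R + c)"
  have c: "c + 2 \<le> 2 ^ (c + 2)" using less_exp[of "c + 2"] by simp
  have "2 * 2 ^ R + c * 1 \<le> 2 * 2 ^ R + c * 2 ^ R" by (intro add_left_mono mult_left_mono) simp_all
  also have "\<dots> = (c + 2) * 2 ^ R" by (simp add: algebra_simps)
  also have "\<dots> \<le> 2 ^ (c + 2) * 2 ^ R" using c by (rule mult_right_mono) simp
  finally have "q \<le> 2 ^ bit_length n * (2 ^ (c + 2) * 2 ^ R)" unfolding q_def by simp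
  then have q: "q \<le> 2 ^ (c + 2 + (bit_length n + R))" by (simp add: power_add mult_ac)
  have "(1 - \<epsilon>) ^ 2 ^ (c + 2 + (k + (bit_length n + R))) = ((1 - \<epsilon>) ^ 2 ^ k) ^ 2 ^ (c + 2 + (bit_length n + R))"
    by (simp add: power_add mult_ac flip: power_mult)
  also have "\<dots> \<le> (1 / 2) ^ 2 ^ (c + 2 + (bit_length n + R))"
    using half assms by (intro power_mono) auto
  also have "\<dots> \<le> (1 / 2) ^ q" using q by (intro power_decreasing) auto
  finally have "real (n + 2) ^ (2 * 2 ^ R + c) * (1 - \<epsilon>) ^ 2 ^ (c + 2 + (k + (bit_length n + R)))
      \<le> 2 ^ q * (1 / 2) ^ q"
    using power_less_tower[of n "2 * 2 ^ R + c"] assms unfolding q_def by (intro mult_mono) auto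
  then have "(real n + 2) ^ c * (real (n + 2) ^ (2 * 2 ^ R) * (1 - \<epsilon>) ^ 2 ^ (c + 2 + (k + (bit_length n + R)))) \<le> 1"
    by (simp add: power_add power_divide mult_ac add.commute)
  then show ?thesis by (simp add: field_simps)
qed

section \<open>Binary digits of \<epsilon>\<close>

lemma first_digit:
  assumes "0 < \<epsilon>" "\<epsilon> < 1"
  obtains k where "1 \<le> k" "digit \<epsilon> k" "\<And>i. i < k \<Longrightarrow> \<not> digit \<epsilon> i" "1 \<le> \<epsilon> * 2 ^ k" "\<epsilon> * 2 ^ k < 2"
proof -
  \<comment> \<open>The least \<open>k\<close> with \<open>\<epsilon> * 2 ^ k \<ge> 1\<close> is the
    position of the leading digit 1, so \<open>2 ^ k\<close> is within a factor 2 of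
    \<open>1 / \<epsilon>\<close>.\<close>
  define k where "k = (LEAST k. 1 \<le> \<epsilon> * 2 ^ k)"
  obtain j where "1 / \<epsilon> < 2 ^ j" using real_arch_pow[of 2 "1 / \<epsilon>"] by auto
  then have "1 \<le> \<epsilon> * 2 ^ j" using assms by (simp add: field_simps)
  then have k: "1 \<le> \<epsilon> * 2 ^ k" unfolding k_def by (rule LeastI)
  have less: "\<epsilon> * 2 ^ i < 1" if "i < k" for i
    using not_less_Least[of i "\<lambda>k. 1 \<le> \<epsilon> * 2 ^ k"] that unfolding k_def by simp
  have k1: "1 \<le> k" using k assms by (cases k) auto
  then have k2: "\<epsilon> * 2 ^ k < 2" using less[of "k - 1"] by (cases k) auto
  have "\<lfloor>\<epsilon> * 2 ^ k\<rfloor> = 1" using k k2 by linarith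
  then have "digit \<epsilon> k" by (simp add: digit_def)
  moreover have "\<not> digit \<epsilon> i" if "i < k" for i
  proof -
    have "\<lfloor>\<epsilon> * 2 ^ i\<rfloor> = 0" using less[OF that] assms by (simp add: floor_eq_iff)
    then show ?thesis by (simp add: digit_def)
  qed
  ultimately show ?thesis using that k1 k k2 by blast
qed

text \<open>In base 2, 7/8 is 0.111.\<close>

lemma easy_accuracy:
  assumes "0 < \<epsilon>" "\<epsilon> < 1" "digit \<epsilon> 1" "digit \<epsilon> 2" "digit \<epsilon> 3"
  shows "7 / 8 \<le> \<epsilon>"
proof -
  have "\<lfloor>\<epsilon> * 2\<rfloor> \<in> {0..1}" "\<lfloor>\<epsilon> * 4\<rfloor> \<in> {0..3}" "\<lfloor>\<epsilon> * 8\<rfloor> \<in> {0..7}"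
    using assms(1,2) by (auto simp: floor_le_iff)
  moreover have "odd \<lfloor>\<epsilon> * 2\<rfloor>" "odd \<lfloor>\<epsilon> * 4\<rfloor>" "odd \<lfloor>\<epsilon> * 8\<rfloor>"
    using assms(3-5) by (auto simp: digit_def)
  ultimately have "1 \<le> \<lfloor>\<epsilon> * 2\<rfloor>"
    by (metis atLeastAtMost_iff even_zero le_less zless_imp_add1_zle add_0)
  then have "2 \<le> \<lfloor>\<epsilon> * 4\<rfloor>" by linarith
  then have "\<lfloor>\<epsilon> * 4\<rfloor> = 3" using \<open>\<lfloor>\<epsilon> * 4\<rfloor> \<in> {0..3}\<close> \<open>odd \<lfloor>\<epsilon> * 4\<rfloor>\<close>
    by (metis atLeastAtMost_iff even_numeral le_less zless_imp_add1_zle order_antisym_conv one_plus_numeral semiring_norm(3) add.commute numeral_Bit1 numeral_One one_add_one)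
  then have "6 \<le> \<lfloor>\<epsilon> * 8\<rfloor>" by linarith
  then have "\<lfloor>\<epsilon> * 8\<rfloor> \<noteq> 6" using \<open>odd \<lfloor>\<epsilon> * 8\<rfloor>\<close> by auto
  then have "7 \<le> \<lfloor>\<epsilon> * 8\<rfloor>" using \<open>6 \<le> \<lfloor>\<epsilon> * 8\<rfloor>\<close> by linarith
  then show ?thesis by linarith
qed

lemma hard_accuracy:
  assumes "\<epsilon> < 1" "\<not> (digit \<epsilon> 1 \<and> digit \<epsilon> 2 \<and> digit \<epsilon> 3)"
  shows "\<epsilon> < 7 / 8"
proof (rule ccontr)
  assume "\<not> \<epsilon> < 7 / 8"
  then have "\<lfloor>\<epsilon> * 2\<rfloor> = 1" "\<lfloor>\<epsilon> * 4\<rfloor> = 3" "\<lfloor>\<epsilon> * 8\<rfloor> = 7"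
    using assms(1) by (auto simp: floor_eq_iff)
  then show False using assms(2) by (simp add: digit_def)
qed

section \<open>Relevant variables and the hypothesis found from a sample\<close>

lemma relevant_vars:
  assumes t: "dt_wf n t" "leaves t \<le> s" "\<forall>x\<in>cube n. dt_eval t x = f x" and xs: "xs \<in> samples n m"
  shows "set (relevant_vars n f xs) \<subseteq> {..<n}" "length (relevant_vars n f xs) < s"
    "\<exists>u. consistent u (label f xs) \<and> leaves u \<le> s \<and> tree_vars u \<subseteq> set (relevant_vars n f xs)"
proof -
  have x: "length x = n" if "(x, y) \<in> set (label f xs)" for x y
    using that xs by (auto simp: label_def samples_def cube_def)
  have eq: "f x = dt_eval t x" if "length x = n" for x using t(3) that by (simp add: cube_def)
  have full: "band x (replicate n True) = x" if "length x = n" for x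
    using that unfolding band_def by (intro nth_equalityI) auto
  have "band x (replicate n True) = x" if "x \<in> set xs" for x
    using full that xs by (auto simp: samples_def cube_def)
  then have init: "agrees f (label f xs) (replicate n True @ [])"
    unfolding agrees_def by (auto simp: label_def)
  have S: "\<forall>(x, y)\<in>set (label f xs). length x = n" using x by auto
  obtain m' where m': "length m' = n" "agrees f (label f xs) m'"
    "set (relevant_vars n f xs) = {i. i < n \<and> m' ! i}"
    "distinct (relevant_vars n f xs)" "set (relevant_vars n f xs) \<subseteq> tree_vars t"
    using elim_vars_invariant[OF eq S tree_vars_less[OF t(1)] _ init, of "[]"]
    unfolding relevant_vars_def by auto
  show "set (relevant_vars n f xs) \<subseteq> {..<n}" using m'(3) by auto
  have "length (relevant_vars n f xs) = card (set (relevant_vars n f xs))"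
    using m'(4) by (simp add: distinct_card)
  also have "\<dots> \<le> card (tree_vars t)" using m'(5) by (simp add: card_mono)
  also have "\<dots> < s" using card_tree_vars_less[of t] t(2) by simp
  finally show "length (relevant_vars n f xs) < s" .
  \<comment> \<open>The witness fixes the coordinates outside the final mask to 0: on the sample it
    computes \<open>f\<close> at the masked points, where the labels agree.\<close>
  have "consistent (mask_tree m' t) (label f xs)"
    unfolding consistent_def
  proof (intro ballI, clarify)
    fix x y assume xy: "(x, y) \<in> set (label f xs)"
    have "dt_eval (mask_tree m' t) x = f (band x m')"
      using mask_tree(3)[OF t(1) x[OF xy] m'(1)] eq[of "band x m'"] x[OF xy] m'(1)
      by (simp add: band_def)
    then show "(dt_eval (mask_tree m' t) x = 1) = y"
      using m'(2) xy by (auto simp: agrees_def)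
  qed
  then show "\<exists>u. consistent u (label f xs) \<and> leaves u \<le> s \<and> tree_vars u \<subseteq> set (relevant_vars n f xs)"
    using mask_tree(1)[of m' t] mask_tree(2)[OF t(1), of m'] t(2) m'(3) by (auto intro: order_trans)
qed

lemma search_relevant:
  assumes t: "dt_wf n t" "leaves t \<le> s" "\<forall>x\<in>cube n. dt_eval t x = f x" and xs: "xs \<in> samples n m"
  obtains h where "search (bit_length s) (relevant_vars n f xs) (label f xs) = Some h" "dt_wf n h"
    "leaves h \<le> 2 ^ (bit_length s * bit_length s)" "\<forall>x\<in>set xs. dt_eval h x = f x"
proof -
  note rel = relevant_vars[OF t xs]
  obtain u where u: "consistent u (label f xs)" "leaves u \<le> s" "tree_vars u \<subseteq> set (relevant_vars n f xs)"
    using rel(3) by blast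
  have "leaves u \<le> 2 ^ bit_length s" using u(2) less_power_bit_length[of s] by linarith
  then obtain h where h: "search (bit_length s) (relevant_vars n f xs) (label f xs) = Some h"
    using search_complete[OF u(1) _ u(3)] by blast
  note sound = search_sound[OF h rel(1)]
  \<comment> \<open>\<open>rel(2)\<close> is strict, so one more than the number of kept variables
    is still at most \<open>s\<close>.\<close>
  have "(length (relevant_vars n f xs) + 1) ^ bit_length s \<le> (2 ^ bit_length s) ^ bit_length s"
    using rel(2) less_power_bit_length[of s] by (intro power_mono) auto
  then have "leaves h \<le> 2 ^ (bit_length s * bit_length s)" using sound by (simp add: power_mult)
  moreover have "dt_eval h x = f x" if "x \<in> set xs" for x
  proof -
    have "(dt_eval h x = 1) = (f x = 1)" using sound that by (auto simp: consistent_def label_def)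
    moreover have "dt_eval h x \<in> {-1, 1}" using sound dt_eval_sign by blast
    moreover have "f x \<in> {-1, 1}" using dt_eval_sign[OF t(1), of x] t(3) that xs by (auto simp: samples_def)
    ultimately show ?thesis by auto
  qed
  ultimately show ?thesis using that h sound by blast
qed

section \<open>The learner and its running time\<close>

lemma size_enc_nat [simp]: "size (enc_nat k) = k"
  by (induction k) auto

text \<open>The summand \<open>n + 8\<close> strengthens the induction: a leaf of value 1 meets the
  bound exactly, and at a node the surplus of the second subtree pays for the \<open>4 + i\<close>
  pairs of the node.\<close>

lemma size_enc_dtree: "dt_wf n t \<Longrightarrow> size (enc_dtree t) + n + 8 \<le> leaves t * (n + 10)"
  by (induction t) (auto simp: enc_sign_def enc_bool_def algebra_simps)

text \<open>Once the first \<open>m * n\<close> coins are read as a sample \<open>xs\<close>, the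
  run is deterministic with result \<open>alg xs\<close>. So it stops in time on every tape, and
  success is guaranteed for samples in \<open>G\<close>. \<open>Z\<close> accounts for writing the
  output.\<close>

lemma properly_learnsI:
  fixes \<delta> :: real
  assumes "\<And>f. dt_computable n s f \<Longrightarrow> \<exists>m B Z alg G.
    m * n \<le> T \<and> B + Z + 2 \<le> T \<and>
    (\<forall>xs\<in>samples n m. size (alg xs) \<le> Z \<and>
      (\<forall>r. calls c n f \<epsilon> 0 (Pair (enc_nat n) (enc_nat s)) (concat xs @ r) (alg xs) r B)) \<and>
    G \<subseteq> samples n m \<and> card (samples n m - G) \<le> \<delta> * card (samples n m) \<and>
    (\<forall>xs\<in>G. \<exists>h. alg xs = enc_dtree h \<and> dt_wf n h \<and> dt_error n h f \<le> \<epsilon>)"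
  shows "properly_learns (prog c) n s \<epsilon> \<delta> T"
  unfolding properly_learns_def
proof (intro allI impI)
  fix f assume "dt_computable n s f"
  from assms[OF this] obtain m B Z alg G where
    T: "m * n \<le> T" "B + Z + 2 \<le> T" and size: "\<And>xs. xs \<in> samples n m \<Longrightarrow> size (alg xs) \<le> Z"
    and alg: "\<And>xs r. xs \<in> samples n m \<Longrightarrow>
      calls c n f \<epsilon> 0 (Pair (enc_nat n) (enc_nat s)) (concat xs @ r) (alg xs) r B"
    and G: "G \<subseteq> samples n m" "card (samples n m - G) \<le> \<delta> * card (samples n m)"
      "\<And>xs. xs \<in> G \<Longrightarrow> \<exists>h. alg xs = enc_dtree h \<and> dt_wf n h \<and> dt_error n h f \<le> \<epsilon>"
    by metis
  have run: "\<exists>t\<le>T. runs (prog c) n s \<epsilon> f (concat xs @ r) (alg xs) t" if "xs \<in> samples n m" for xs r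
  proof -
    \<comment> \<open>The initial call and its argument are the two extra steps.\<close>
    have "evals c n f \<epsilon> [Pair (enc_nat n) (enc_nat s)] (concat xs @ r) (Call 0 (Var 0)) (alg xs) r (1 + B + 1)"
      by (rule evals_Call[OF evals_Var]) (use alg[OF that] in simp_all)
    then obtain t where "t \<le> B + 2"
      "eval (prog c) n f \<epsilon> [Pair (enc_nat n) (enc_nat s)] (concat xs @ r) (Call 0 (Var 0)) (alg xs) r t"
      unfolding evals_def by auto
    then show ?thesis using size[OF that] T(2) unfolding runs_def
      by (intro exI[of _ "t + size (alg xs)"]) auto
  qed
  show "(\<forall>r. length r = T \<longrightarrow> (\<exists>v t. runs (prog c) n s \<epsilon> f r v t \<and> t \<le> T)) \<and>
    1 - \<delta> \<le> measure_pmf.prob (pmf_of_set {r. length r = T})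
      {r. \<exists>h t. runs (prog c) n s \<epsilon> f r (enc_dtree h) t \<and> dt_wf n h \<and> dt_error n h f \<le> \<epsilon>}"
  proof (intro conjI allI impI)
    fix r :: "bool list" assume "length r = T"
    then obtain xs r' where "xs \<in> samples n m" "r = concat xs @ r'" using split_tape[of m n r] T(1) by auto
    then show "\<exists>v t. runs (prog c) n s \<epsilon> f r v t \<and> t \<le> T" using run by blast
  next
    show "1 - \<delta> \<le> measure_pmf.prob (pmf_of_set {r. length r = T})
      {r. \<exists>h t. runs (prog c) n s \<epsilon> f r (enc_dtree h) t \<and> dt_wf n h \<and> dt_error n h f \<le> \<epsilon>}"
    proof (rule tape_prob[OF T(1) G(2) G(1)])
      fix xs r assume xs: "xs \<in> G"
      then show "concat xs @ r \<in> {r. \<exists>h t. runs (prog c) n s \<epsilon> f r (enc_dtree h) t \<and> dt_wf n h \<and> dt_error n h f \<le> \<epsilon>}"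
        using G(3)[OF xs] run[of xs r] G(1) by fastforce
    qed
  qed
qed

section \<open>Easy parameters: the majority vote\<close>

lemma learns_easy:
  assumes s: "1 \<le> s" and \<epsilon>: "0 < \<epsilon>" "\<epsilon> < 1" and easy: "easy \<epsilon> s"
    and T: "500 * 2 ^ (c + 4) * (n + 1)\<^sup>2 \<le> T"
  shows "properly_learns (prog c) n s \<epsilon> (1 / (real n + 2) ^ c) T"
proof (rule properly_learnsI)
  fix f assume "dt_computable n s f"
  then obtain t where t: "dt_wf n t" "leaves t \<le> s" "\<forall>x\<in>cube n. dt_eval t x = f x"
    by (auto simp: dt_computable_def)
  have f: "\<forall>x\<in>cube n. f x \<in> {-1, 1}" using dt_eval_sign[OF t(1)] t(3) by metis
  define m where "m = (2::nat) ^ (c + 2 + bit_length n)"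
  define B where "B = 100 * n + (50 * n + 300) * (m + 1) + 2 * c + 300"
  define G where "G = {xs \<in> samples n m. dt_error n (Leaf (majority f xs)) f \<le> \<epsilon>}"
  define alg where "alg xs = enc_dtree (Leaf (majority f xs))" for xs
  have time: "B + 2 + 2 \<le> T"
  proof -
    define a where "a = (2::nat) ^ (c + 2)"
    define Q where "Q = a * (n + 1)\<^sup>2"
    have lg: "2 ^ bit_length n \<le> 2 * (n + 1)" using power_bit_length_le[of n] by (cases "n = 0") auto
    have "m = a * 2 ^ bit_length n" by (simp add: m_def a_def power_add)
    also have "\<dots> \<le> a * (2 * (n + 1))" using lg by (rule mult_left_mono) simp
    finally have m: "m \<le> 2 * (a * (n + 1))" by simp
    have a: "1 \<le> a" "c \<le> a" unfolding a_def using less_exp[of "c + 2"] by simp_all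
    have an: "1 \<le> a * (n + 1)" using a(1) by simp
    have "m + 1 \<le> 3 * (a * (n + 1))" using add_mono[OF m an] by simp
    then have "(50 * n + 300) * (m + 1) \<le> (300 * (n + 1)) * (3 * (a * (n + 1)))"
      by (intro mult_le_mono) simp_all
    also have "\<dots> = 900 * Q" by (simp add: Q_def power2_eq_square algebra_simps)
    finally have "(50 * n + 300) * (m + 1) \<le> 900 * Q" .
    moreover have "(n + 1) * 1 \<le> (n + 1) * (a * (n + 1))" using an by (rule mult_left_mono) simp
    then have "n + 1 \<le> Q"
      unfolding Q_def power2_eq_square by (simp only: mult_1_right mult_1_left mult_ac)
    moreover have "a * 1 \<le> a * (n + 1)\<^sup>2" by (rule mult_left_mono) simp_all
    then have "c \<le> Q" using a(2) unfolding Q_def by linarith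
    ultimately have "B + 2 + 2 \<le> 2000 * Q" unfolding B_def by linarith
    also have "\<dots> = 500 * 2 ^ (c + 4) * (n + 1)\<^sup>2" by (simp add: Q_def a_def power_add)
    finally show ?thesis using T by simp
  qed
  have "m * n \<le> B" unfolding B_def by (simp add: algebra_simps)
  moreover have "size (alg xs) \<le> 2 \<and> (\<forall>r. calls c n f \<epsilon> 0 (Pair (enc_nat n) (enc_nat s)) (concat xs @ r) (alg xs) r B)"
    if "xs \<in> samples n m" for xs
  proof -
    have "\<forall>x\<in>set xs. length x = n" "length xs = m" using that by (auto simp: samples_def cube_def)
    then show ?thesis using calls_main_easy[OF s easy, of xs n c f]
      by (simp add: alg_def B_def m_def enc_sign_def enc_bool_def)
  qed
  moreover have "card (samples n m - G) \<le> 1 / (real n + 2) ^ c * card (samples n m)"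
  \<comment> \<open>A tree with one leaf is constant, and then no sample is bad; otherwise
    \<epsilon> is at least 7/8 and the tail bound applies.\<close>
  proof (cases "s = 1")
    case True
    have "leaves u + leaves v > 1" for u v using leaves_ge_1[of u] leaves_ge_1[of v] by linarith
    then obtain b where b: "t = Leaf b" using t(2) True by (cases t) (simp_all add: not_le[symmetric])
    have empty: "samples n m - G = {}"
      using majority_const[of n f b _ m] t \<epsilon> unfolding b G_def m_def by auto
    show ?thesis unfolding empty by simp
  next
    case False
    then have "7 / 8 \<le> \<epsilon>" using easy easy_accuracy[OF \<epsilon>] by (simp add: easy_def)
    moreover have "samples n m - G = {xs \<in> samples n m. dt_error n (Leaf (majority f xs)) f > \<epsilon>}"
      by (auto simp: G_def)
    ultimately have "card (samples n m - G) \<le> (11 / 16) ^ m * card (samples n m)"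
      using majority_errs[OF f] by simp
    also have "\<dots> \<le> 1 / (real n + 2) ^ c * card (samples n m)"
      unfolding m_def by (intro mult_right_mono majority_confidence) simp
    finally show ?thesis .
  qed
  moreover have "\<exists>h. alg xs = enc_dtree h \<and> dt_wf n h \<and> dt_error n h f \<le> \<epsilon>" if "xs \<in> G" for xs
    using that by (intro exI[of _ "Leaf (majority f xs)"]) (auto simp: alg_def G_def majority_def)
  ultimately show "\<exists>m B Z alg G.
    m * n \<le> T \<and> B + Z + 2 \<le> T \<and>
    (\<forall>xs\<in>samples n m. size (alg xs) \<le> Z \<and>
      (\<forall>r. calls c n f \<epsilon> 0 (Pair (enc_nat n) (enc_nat s)) (concat xs @ r) (alg xs) r B)) \<and>
    G \<subseteq> samples n m \<and> card (samples n m - G) \<le> 1 / (real n + 2) ^ c * card (samples n m) \<and>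
    (\<forall>xs\<in>G. \<exists>h. alg xs = enc_dtree h \<and> dt_wf n h \<and> dt_error n h f \<le> \<epsilon>)"
    using time G_def by (intro exI[of _ m] exI[of _ B] exI[of _ 2] exI[of _ alg] exI[of _ G]) auto
qed


section \<open>Hard parameters: elimination and search\<close>

lemma hard_time:
  assumes "r = bit_length s" "m = 2 ^ (c + 2 + (k + (bit_length n + r * r)))"
  shows "search_time n s m r s + (400 * n + 600) * (n + 1) * (m + 1) + 100 * s
    + 100 * (r + 1)\<^sup>2 + (k + 30)\<^sup>2 + 20 * bit_length n + 2 * c + 2 ^ (r * r) * (n + 10) + 2
    \<le> 10000 * 2 ^ (c + 4) * ((n + 1) * 2 ^ (r * r) * 2 ^ k) ^ 8"
proof -
  \<comment> \<open>Up to constants and the factor \<open>a\<close>, every quantity is bounded by a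
    power of \<open>Z\<close>. The eighth power comes from the search time: one factor each for the
    sample and \<open>n + 1\<close>, two for \<open>s + 1\<close>, and four for the power with
    exponent \<open>r\<close>.\<close>
  define W E a where "W = (2::nat) ^ (r * r)" and "E = (2::nat) ^ k" and "a = (2::nat) ^ (c + 2)"
  define Z P where "Z = (n + 1) * W * E" and "P = Z ^ 8"
  have W: "1 \<le> W" and E: "1 \<le> E" by (simp_all add: W_def E_def)
  have WE: "1 \<le> W * E" "1 \<le> (n + 1) * E" "1 \<le> (n + 1) * W" using W E by simp_all
  have n: "n + 1 \<le> Z" using mult_le_mono2[OF WE(1), of "n + 1"]
    by (simp only: Z_def mult_1_right mult_1_left mult_ac)
  have WZ: "W \<le> Z" using mult_le_mono2[OF WE(2), of W]
    by (simp only: Z_def mult_1_right mult_1_left mult_ac)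
  have EZ: "E \<le> Z" using mult_le_mono2[OF WE(3), of E]
    by (simp only: Z_def mult_1_right mult_1_left mult_ac)
  have Z: "1 \<le> Z" using n by simp
  have rr: "r \<le> r * r" by simp
  have two: "2 ^ r \<le> W" unfolding W_def using rr by (rule power_increasing) simp
  have s: "s + 1 \<le> Z" using less_power_bit_length[of s] two WZ unfolding assms(1) by linarith
  have r: "r + 1 \<le> Z" using less_exp[of r] two WZ by linarith
  have k: "k + 30 \<le> 31 * Z" using less_exp[of k] EZ Z unfolding E_def by linarith
  have lg: "2 ^ bit_length n \<le> 2 * (n + 1)" using power_bit_length_le[of n] by (cases "n = 0") auto
  have "bit_length n \<le> 2 ^ bit_length n" by (rule less_imp_le) (rule less_exp)
  also note lg
  also have "2 * (n + 1) \<le> 2 * Z" using n by (rule mult_left_mono) simp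
  finally have lgn: "bit_length n \<le> 2 * Z" .
  have a: "1 \<le> a" "c \<le> a" unfolding a_def using less_exp[of "c + 2"] by simp_all
  have "m = a * (E * W) * 2 ^ bit_length n" unfolding assms(2) a_def E_def W_def by (simp add: power_add)
  also have "\<dots> \<le> a * (E * W) * (2 * (n + 1))" using lg by (rule mult_left_mono) simp
  also have "\<dots> = 2 * (a * Z)" by (simp only: Z_def mult_ac)
  finally have "m \<le> 2 * (a * Z)" .
  moreover have "1 \<le> a * Z" using a(1) Z by simp
  ultimately have m: "m + 1 \<le> 3 * (a * Z)" by linarith
  have "4 * (s + 1)\<^sup>2 \<le> 4 * (2 ^ r)\<^sup>2"
    using less_power_bit_length[of s] unfolding assms(1) by (intro mult_left_mono power_mono) simp_all
  then have "(4 * (s + 1)\<^sup>2) ^ r \<le> (4 * (2 ^ r)\<^sup>2) ^ r" by (rule power_mono) simp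
  also have "4 * (2 ^ r)\<^sup>2 = (2::nat) ^ (2 + 2 * r)"
    by (simp add: power_add mult.commute flip: power_mult)
  also have "\<dots> ^ r = 2 ^ (2 * r + 2 * (r * r))"
    by (simp only: power_mult[symmetric] distrib_right mult.assoc)
  also have "\<dots> \<le> 2 ^ (4 * (r * r))" using rr by (intro power_increasing) (linarith | simp)+
  also have "\<dots> = W ^ 4" by (simp add: W_def mult.commute flip: power_mult)
  also have "\<dots> \<le> Z ^ 4" using WZ by (rule power_mono) simp
  finally have pow: "(4 * (s + 1)\<^sup>2) ^ r \<le> Z ^ 4" .
  have le: "Z ^ i \<le> P" if "i \<le> 8" for i unfolding P_def using that Z by (rule power_increasing)
  have aP: "P \<le> a * P" using a(1) by simp
  have leZ: "Z \<le> P" using le[of 1] by simp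
  have "search_time n s m r s \<le> 1000 * (3 * (a * Z)) * Z * Z * Z * Z ^ 4"
    unfolding search_time_def level_cost_def using m n s pow by (intro mult_le_mono) simp_all
  also have "\<dots> = 3000 * (a * P)"
    using power_add[of Z 4 4] by (simp add: P_def power4_eq_xxxx)
  finally have 1: "search_time n s m r s \<le> 3000 * (a * P)" .
  have "(400 * n + 600) * (n + 1) * (m + 1) \<le> (600 * Z) * Z * (3 * (a * Z))"
    using m n by (intro mult_le_mono) linarith+
  also have "\<dots> = 1800 * (a * Z ^ 3)" by (simp add: power3_eq_cube)
  also have "\<dots> \<le> 1800 * (a * P)" using le[of 3] by simp
  finally have 2: "(400 * n + 600) * (n + 1) * (m + 1) \<le> 1800 * (a * P)" .
  have "(r + 1)\<^sup>2 \<le> Z\<^sup>2" using r by (rule power_mono) simp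
  also have "\<dots> \<le> P" by (rule le) simp
  finally have 3: "(r + 1)\<^sup>2 \<le> P" .
  have "(k + 30)\<^sup>2 \<le> (31 * Z)\<^sup>2" using k by (rule power_mono) simp
  also have "\<dots> \<le> 961 * P" using le[of 2] by (simp add: power_mult_distrib)
  finally have 4: "(k + 30)\<^sup>2 \<le> 961 * P" .
  have "W * (n + 10) \<le> Z * (10 * Z)" using WZ n by (intro mult_le_mono) linarith+
  also have "\<dots> \<le> 10 * P" using le[of 2] by (simp add: power2_eq_square)
  finally have 5: "W * (n + 10) \<le> 10 * P" .
  have 6: "c \<le> a * P" using mult_le_mono[OF a(2), of 1 P] Z leZ by simp
  have "10000 * 2 ^ (c + 4) * ((n + 1) * 2 ^ (r * r) * 2 ^ k) ^ 8 = 40000 * (a * P)"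
    unfolding P_def Z_def W_def E_def a_def by (simp add: power_add)
  then show ?thesis using 1 2 3 4 5 6 aP leZ s lgn Z unfolding W_def by linarith
qed

lemma learns_hard:
  assumes s: "1 \<le> s" and \<epsilon>: "0 < \<epsilon>" "\<epsilon> < 1" and hard: "\<not> easy \<epsilon> s"
    and k: "1 \<le> k" "digit \<epsilon> k" "\<And>i. i < k \<Longrightarrow> \<not> digit \<epsilon> i" "1 \<le> \<epsilon> * 2 ^ k"
    and T: "10000 * 2 ^ (c + 4) * ((n + 1) * 2 ^ (bit_length s * bit_length s) * 2 ^ k) ^ 8 \<le> T"
  shows "properly_learns (prog c) n s \<epsilon> (1 / (real n + 2) ^ c) T"
proof (rule properly_learnsI)
  fix f assume "dt_computable n s f"
  then obtain t where t: "dt_wf n t" "leaves t \<le> s" "\<forall>x\<in>cube n. dt_eval t x = f x"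
    by (auto simp: dt_computable_def)
  define r where "r = bit_length s"
  define W where "W = (2::nat) ^ (r * r)"
  define m where "m = (2::nat) ^ (c + 2 + (k + (bit_length n + r * r)))"
  define B where "B = search_time n s m r s + (400 * n + 600) * (n + 1) * (m + 1) + 100 * s
    + 100 * (r + 1)\<^sup>2 + (k + 30)\<^sup>2 + 20 * bit_length n + 2 * c"
  define Z where "Z = W * (n + 10)"
  define alg where "alg xs = enc_opt (search r (relevant_vars n f xs) (label f xs))" for xs
  \<comment> \<open>The good samples do not refer to the search: every small consistent tree has
    small error, in particular the one found.\<close>
  define G where "G = {xs \<in> samples n m. \<forall>h. dt_wf n h \<and> leaves h \<le> W \<and>
    (\<forall>x\<in>set xs. dt_eval h x = f x) \<longrightarrow> dt_error n h f \<le> \<epsilon>}"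
  have time: "B + Z + 2 \<le> T"
    using order_trans[OF hard_time[OF r_def m_def] T[folded r_def]]
    unfolding B_def Z_def W_def .
  have "m * n \<le> B" unfolding B_def by (simp add: algebra_simps)
  moreover have "size (alg xs) \<le> Z \<and> (\<forall>tp. calls c n f \<epsilon> 0 (Pair (enc_nat n) (enc_nat s)) (concat xs @ tp) (alg xs) tp B)"
    if xs: "xs \<in> samples n m" for xs
  proof
    obtain h where h: "search r (relevant_vars n f xs) (label f xs) = Some h" "dt_wf n h" "leaves h \<le> W"
      using search_relevant[OF t xs] unfolding r_def W_def by blast
    have "leaves h * (n + 10) \<le> Z" unfolding Z_def using h(3) by (rule mult_right_mono) simp
    then show "size (alg xs) \<le> Z" unfolding alg_def h(1) using size_enc_dtree[OF h(2)] by simp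
    note rel = relevant_vars[OF t xs]
    have le: "search_time n s m r (length (relevant_vars n f xs)) \<le> search_time n s m r s"
      unfolding search_time_def using rel(2) by (intro mult_right_mono mult_left_mono) simp_all
    have run: "calls c n f \<epsilon> 0 (Pair (enc_nat n) (enc_nat s)) (concat xs @ tp) (alg xs) tp
      (search_time n s m r (length (relevant_vars n f xs))
      + (400 * n + 600) * (n + 1) * (m + 1) + 100 * s + 100 * (r + 1)\<^sup>2 + (k + 30)\<^sup>2
      + 20 * bit_length n + 2 * c)" for tp
      using calls_main_hard[OF s hard, where xs = xs and n = n and c = c and k = k and f = f and r = tp] xs rel(1,2) k
      unfolding alg_def r_def m_def by (simp add: samples_def cube_def subset_iff)
    show "\<forall>tp. calls c n f \<epsilon> 0 (Pair (enc_nat n) (enc_nat s)) (concat xs @ tp) (alg xs) tp B"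
      by (intro allI, rule calls_weaken[OF run]) (use le in \<open>simp_all add: B_def\<close>)
  qed
  moreover have "card (samples n m - G) \<le> 1 / (real n + 2) ^ c * card (samples n m)"
  proof -
    have "samples n m - G = {xs \<in> samples n m. \<exists>h. dt_wf n h \<and> leaves h \<le> W \<and> dt_error n h f > \<epsilon> \<and>
      (\<forall>x\<in>set xs. dt_eval h x = f x)}" by (auto simp: G_def not_le)
    then have "real (card (samples n m - G)) \<le> real (n + 2) ^ (2 * W) * (1 - \<epsilon>) ^ m * card (samples n m)"
      using occam[OF \<epsilon>, of n m W f] by simp
    also have "\<dots> \<le> 1 / (real n + 2) ^ c * card (samples n m)"
      unfolding m_def W_def by (intro mult_right_mono occam_confidence \<epsilon> k(4)) simp
    finally show ?thesis .
  qed
  moreover have "\<exists>h. alg xs = enc_dtree h \<and> dt_wf n h \<and> dt_error n h f \<le> \<epsilon>" if "xs \<in> G" for xs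
  proof -
    have xs: "xs \<in> samples n m" using that by (simp add: G_def)
    obtain h where h: "search r (relevant_vars n f xs) (label f xs) = Some h" "dt_wf n h" "leaves h \<le> W"
      "\<forall>x\<in>set xs. dt_eval h x = f x"
      using search_relevant[OF t xs] unfolding r_def W_def by blast
    then show ?thesis using that by (intro exI[of _ h]) (auto simp: alg_def G_def)
  qed
  ultimately show "\<exists>m B Z alg G.
    m * n \<le> T \<and> B + Z + 2 \<le> T \<and>
    (\<forall>xs\<in>samples n m. size (alg xs) \<le> Z \<and>
      (\<forall>r. calls c n f \<epsilon> 0 (Pair (enc_nat n) (enc_nat s)) (concat xs @ r) (alg xs) r B)) \<and>
    G \<subseteq> samples n m \<and> card (samples n m - G) \<le> 1 / (real n + 2) ^ c * card (samples n m) \<and>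
    (\<forall>xs\<in>G. \<exists>h. alg xs = enc_dtree h \<and> dt_wf n h \<and> dt_error n h f \<le> \<epsilon>)"
    using time G_def by (intro exI[of _ m] exI[of _ B] exI[of _ Z] exI[of _ alg] exI[of _ G]) auto
qed


section \<open>Comparison with the claimed quasipolynomial bound\<close>

lemma quasipolynomial_bounds:
  fixes s :: nat and \<epsilon> :: real
  defines "Y \<equiv> real s powr (log 2 (real s / \<epsilon>) * log 2 (1 / \<epsilon>))"
  assumes s: "2 \<le> s" and \<epsilon>: "0 < \<epsilon>" "\<epsilon> < 7 / 8"
  shows "1 / \<epsilon> \<le> Y" "2 ^ (bit_length s * bit_length s) \<le> Y ^ 24"
proof -
  \<comment> \<open>In these terms \<open>log 2 Y = L * (L + E) * E \<ge> L * L * E\<close>. With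
    \<open>L \<ge> 1\<close> this dominates \<open>E\<close>; with \<open>E \<ge> 1/6\<close> the
    squared bit length, at most \<open>4 * L * L\<close>, is at most 24 times as large.\<close>
  define L E where "L = log 2 (real s)" and "E = log 2 (1 / \<epsilon>)"
  have L: "1 \<le> L" using s by (simp add: L_def)
  have "1 = log 2 2" by simp
  \<comment> \<open>As \<epsilon> < 7/8, a sixth power of \<open>1 / \<epsilon>\<close> exceeds 2;
    this keeps \<open>E\<close> away from 0.\<close>
  also have "\<dots> \<le> log 2 ((8 / 7) ^ 6)" by (subst log_le_cancel_iff) (simp_all add: power_divide)
  also have "\<dots> = 6 * log 2 (8 / 7)" by (subst log_nat_power) simp_all
  also have "log 2 (8 / 7) \<le> E"
    unfolding E_def using \<epsilon> by (subst log_le_cancel_iff) (simp_all add: field_simps)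
  finally have E: "1 \<le> 6 * E" by simp
  have "Y = 2 powr (L * ((L + E) * E))"
  proof -
    have "log 2 (real s / \<epsilon>) = L + E"
      using s \<epsilon> by (simp add: L_def E_def log_divide)
    moreover have "real s = 2 powr L" using s by (simp add: L_def)
    ultimately show ?thesis unfolding Y_def E_def[symmetric] by (metis powr_powr)
  qed
  note Y = this
  have LL: "1 \<le> L * L" using L by (simp add: mult_ge1_I)
  have LEE: "L * L * E \<le> L * ((L + E) * E)" using L E by (simp add: algebra_simps)
  have "1 / \<epsilon> = 2 powr E" using \<epsilon> by (simp add: E_def)
  also have "\<dots> \<le> Y"
  proof -
    have "E \<le> L * ((L + E) * E)" using LEE mult_right_mono[OF LL, of E] E by linarith
    then show ?thesis unfolding Y by simp
  qed
  finally show "1 / \<epsilon> \<le> Y" .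
  have "real (2 ^ bit_length s) \<le> real (2 * s)"
    using power_bit_length_le[of s] s unfolding of_nat_le_iff by simp
  then have "2 powr real (bit_length s) \<le> 2 powr (1 + L)"
    using s by (simp add: powr_add L_def powr_realpow)
  then have "real (bit_length s) \<le> 1 + L" by simp
  then have lg: "real (bit_length s) \<le> 2 * L" using L by linarith
  have "real (bit_length s) * real (bit_length s) \<le> (2 * L) * (2 * L)"
    by (intro mult_mono lg) (use L in simp_all)
  also have "\<dots> = 4 * (L * L) * 1" by simp
  also have "\<dots> \<le> 4 * (L * L) * (6 * E)" using E by (rule mult_left_mono) simp
  also have "\<dots> \<le> L * ((L + E) * E) * 24" using LEE by simp
  finally have "2 powr real (bit_length s * bit_length s) \<le> 2 powr (L * ((L + E) * E) * 24)" by simp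
  also have "\<dots> = Y powr real 24" unfolding Y by (simp add: powr_powr)
  also have "\<dots> = Y ^ 24" by (rule powr_realpow) (simp add: Y)
  finally show "2 ^ (bit_length s * bit_length s) \<le> Y ^ 24" by (simp add: powr_realpow[symmetric])
qed

text \<open>High probability means failure below an inverse polynomial of any prescribed degree. The
  degree is built into the program and costs only a constant factor of time; \<open>n + 2\<close>
  keeps the base at least 2.\<close>

theorem theorem2p7:
  fixes c :: nat
  shows "\<exists>(p :: program) (C :: real) (k :: nat).
    \<forall>(n :: nat) (s :: nat) (\<epsilon> :: real). 1 \<le> s \<longrightarrow> 0 < \<epsilon> \<longrightarrow> \<epsilon> < 1 \<longrightarrow>
      properly_learns p n s \<epsilon> (1 / (real n + 2) ^ c)
        (nat \<lfloor>C * (real n + real s powr (log 2 (real s / \<epsilon>) * log 2 (1 / \<epsilon>))) ^ k\<rfloor>)"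
proof (rule exI[of _ "prog c"], rule exI[of _ "10000 * 2 ^ (c + 4) * 2 ^ 8"], rule exI[of _ 208], intro allI impI)
  fix n s :: nat and \<epsilon> :: real
  assume s: "1 \<le> s" and \<epsilon>: "0 < \<epsilon>" "\<epsilon> < 1"
  define Y where "Y = real s powr (log 2 (real s / \<epsilon>) * log 2 (1 / \<epsilon>))"
  define X where "X = real n + Y"
  have "1 \<le> real s / \<epsilon>" "1 \<le> 1 / \<epsilon>" using s \<epsilon> by (simp_all add: field_simps)
  then have "0 \<le> log 2 (real s / \<epsilon>)" "0 \<le> log 2 (1 / \<epsilon>)" by (simp_all only: zero_le_log_cancel_iff)
  then have Y1: "1 \<le> Y" unfolding Y_def using s by (intro ge_one_powr_ge_zero mult_nonneg_nonneg) simp_all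
  then have X: "real (n + 1) \<le> X" "Y \<le> X" "1 \<le> X" by (simp_all add: X_def)
  \<comment> \<open>In the hard case the three factors are at most \<open>X\<close>,
    \<open>X ^ 24\<close> and \<open>2 * X\<close>. Their product to the power 8 explains the
    exponent 208 = 8 * 26 and the constant \<open>2 ^ 8\<close>.\<close>
  let ?T = "nat \<lfloor>10000 * 2 ^ (c + 4) * 2 ^ 8 * X ^ 208\<rfloor>"
  have "properly_learns (prog c) n s \<epsilon> (1 / (real n + 2) ^ c) ?T"
  proof (cases "easy \<epsilon> s")
    case True
    have "real (500 * 2 ^ (c + 4) * (n + 1)\<^sup>2) = 500 * 2 ^ (c + 4) * (real (n + 1))\<^sup>2" by simp
    also have "\<dots> \<le> (10000 * 2 ^ (c + 4) * 2 ^ 8) * X ^ 208"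
    proof (rule mult_mono)
      have "(real (n + 1))\<^sup>2 \<le> X\<^sup>2" using X by (intro power_mono) simp_all
      also have "\<dots> \<le> X ^ 208" using X by (intro power_increasing) simp_all
      finally show "(real (n + 1))\<^sup>2 \<le> X ^ 208" .
    qed (use X in simp_all)
    finally have "500 * 2 ^ (c + 4) * (n + 1)\<^sup>2 \<le> ?T" by (rule le_nat_floor)
    then show ?thesis by (rule learns_easy[OF s \<epsilon> True])
  next
    case False
    then have s2: "2 \<le> s" and e: "\<epsilon> < 7 / 8"
      using s \<epsilon> hard_accuracy by (auto simp: easy_def)
    note bounds = quasipolynomial_bounds[OF s2 \<epsilon>(1) e, folded Y_def]
    obtain k where k: "1 \<le> k" "digit \<epsilon> k" "\<And>i. i < k \<Longrightarrow> \<not> digit \<epsilon> i" "1 \<le> \<epsilon> * 2 ^ k" "\<epsilon> * 2 ^ k < 2"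
      using first_digit[OF \<epsilon>] by blast
    have "2 ^ k \<le> 2 * (1 / \<epsilon>)" using k(5) \<epsilon>(1) by (simp add: field_simps)
    then have "2 ^ k \<le> 2 * X" using bounds(1) X(2) by linarith
    moreover have "2 ^ (bit_length s * bit_length s) \<le> X ^ 24"
      using bounds(2) power_mono[OF X(2), of 24] Y1 by linarith
    ultimately have "real (n + 1) * 2 ^ (bit_length s * bit_length s) * 2 ^ k \<le> X * X ^ 24 * (2 * X)"
      using X by (intro mult_mono) simp_all
    also have "\<dots> = 2 * X ^ 26" using power_add[of X 2 24] by (simp add: power2_eq_square)
    finally have "(real (n + 1) * 2 ^ (bit_length s * bit_length s) * 2 ^ k) ^ 8 \<le> (2 * X ^ 26) ^ 8"
      by (rule power_mono) simp
    also have "\<dots> = 2 ^ 8 * X ^ 208" unfolding power_mult_distrib by (simp flip: power_mult)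
    finally have "10000 * 2 ^ (c + 4) * (real (n + 1) * 2 ^ (bit_length s * bit_length s) * 2 ^ k) ^ 8
        \<le> 10000 * 2 ^ (c + 4) * (2 ^ 8 * X ^ 208)" by (rule mult_left_mono) simp
    then have "real (10000 * 2 ^ (c + 4) * ((n + 1) * 2 ^ (bit_length s * bit_length s) * 2 ^ k) ^ 8)
        \<le> 10000 * 2 ^ (c + 4) * 2 ^ 8 * X ^ 208"
      by (simp only: of_nat_mult of_nat_power of_nat_numeral mult.assoc)
    then have "10000 * 2 ^ (c + 4) * ((n + 1) * 2 ^ (bit_length s * bit_length s) * 2 ^ k) ^ 8 \<le> ?T"
      by (rule le_nat_floor)
    then show ?thesis by (intro learns_hard[OF s \<epsilon> False k(1,2) _ k(4)] k(3))
  qed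
  then show "properly_learns (prog c) n s \<epsilon> (1 / (real n + 2) ^ c)
      (nat \<lfloor>10000 * 2 ^ (c + 4) * 2 ^ 8 *
        (real n + real s powr (log 2 (real s / \<epsilon>) * log 2 (1 / \<epsilon>))) ^ 208\<rfloor>)"
    unfolding X_def Y_def .
qed

end
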